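(* Let $\mathbb{K}$ be an algebraically closed field of characteristic $2$, $n\geq 1$, and $\mathfrak{g}=\mathfrak{o}^{(1)}(2n+1)$. Assume that every derivation of $\mathfrak{g}$ is the restriction to $\mathfrak{g}$ of $\mathrm{ad}_A$ for some $A\in\mathfrak{o}(2n+1)$. Then for every $\mathbb{Z}/2$-grading of $\mathfrak{g}$, the associated Lie superalgebra $S(\mathfrak{g}^{<1>})$ is isomorphic to one of $\mathfrak{oo}^{(1)}_{II}(2n+1-2k|2k)$ with $0\leq k\leq n$, or $\mathfrak{oo}^{(1)}_{I\Pi}(2n+1-2k|2k)$ with $1\leq k\leq n$.
   Context: A Lie superalgebra in characteristic $2$: superspace $\mathfrak{h}=\mathfrak{h}_{\bar0}\oplus\mathfrak{h}_{\bar1}$, $\mathfrak{h}_{\bar0}$ a Lie algebra, $\mathfrak{h}_{\bar1}$ an $\mathfrak{h}_{\bar0}$-module, squaring $x\mapsto x^2\in\mathfrak{h}_{\bar0}$ on $\mathfrak{h}_{\bar1}$ with $(ax)^2=a^2x^2$, $[x,y]:=(x+y)^2-x^2-y^2$ bilinear, $[x^2,y]=[x,[x,y]]$, $[x^2,x]=0$. For a Lie superalgebra $\mathfrak{h}$, $\mathfrak{h}^{(1)}$ is the span of all brackets and all squares of odd elements. A $\mathbb{Z}/2$-grading of a Lie algebra $\mathfrak{g}$: $\mathfrak{g}=\mathfrak{g}_{\bar0}\oplus\mathfrak{g}_{\bar1}$ with $[\mathfrak{g}_i,\mathfrak{g}_j]\subset\mathfrak{g}_{i+j}$. For centerless $\mathfrak{g}$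 identified with $\mathrm{ad}\,\mathfrak{g}\subset\mathrm{Der}\,\mathfrak{g}$, $\mathfrak{g}^{<1>}$ is the smallest Lie subalgebra of $\mathrm{Der}\,\mathfrak{g}$ containing $\mathrm{ad}\,\mathfrak{g}$ and all $(\mathrm{ad}_x)^2$, $x\in\mathfrak{g}_{\bar1}$, graded by: a derivation is even if it preserves each $\mathfrak{g}_i$, odd if it maps $\mathfrak{g}_i$ into $\mathfrak{g}_{i+1}$. $S(\mathfrak{g}^{<1>})$ is the Lie superalgebra on $\mathfrak{g}^{<1>}$ with the same brackets involving even elements and squaring $x^2:=(\mathrm{ad}_x)^2$ for odd $x$. For a nondegenerate symmetric Gram matrix $G$, $\mathfrak{o}_G(m)=\{X\in\mathfrak{gl}(m): X^TG+GX=0\}$; $\mathfrak{o}(2n+1)=\mathfrak{o}_I(2n+1)$ ($I$ the identity). For Gram matrices $B_1$ ($a\times a$) and $B_2$ ($b\times b$), $\mathfrak{oo}_{B_1B_2}(a|b)$ is the Lie superalgebra of supermatrices $X\in\mathfrak{gl}(a|b)$ (block-diagonal even, block-off-diagonal odd, bracket commutator, squaring of odd matrices the matrix square) with $X^TG+GX=0$, $G=\mathrm{diag}(B_1,B_2)$; $\Pi_{2k}=\begin{pmatrix}0&I_k\\ I_k&0\end{pmatrix}$; by convention $\mathfrak{oo}_{B_1B_2}(a|0)=\mathfrak{o}_{B_1}(a)$ and $\mathfrak{oo}_{B_1B_2}(0|b)=\mathfrak{o}_{B_2}(b)$. *)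

theory Defs
  imports "Jordan_Normal_Form.Matrix" "HOL-Computational_Algebra.Polynomial"
begin

definition comm :: "'a::comm_ring mat \<Rightarrow> 'a mat \<Rightarrow> 'a mat" where
  "comm X Y = X * Y - Y * X"

inductive_set lspan :: "nat \<Rightarrow> 'a::field mat set \<Rightarrow> 'a mat set" for N S where
  lspan_zero: "0\<^sub>m N N \<in> lspan N S"
| lspan_gen: "x \<in> S \<Longrightarrow> x \<in> lspan N S"
| lspan_add: "x \<in> lspan N S \<Longrightarrow> y \<in> lspan N S \<Longrightarrow> x + y \<in> lspan N S"
| lspan_smult: "x \<in> lspan N S \<Longrightarrow> c \<cdot>\<^sub>m x \<in> lspan N S"

definition orth_G :: "'a::field mat \<Rightarrow> nat \<Rightarrow> 'a mat set" where
  "orth_G G m = {X \<in> carrier_mat m m. transpose_mat X * G + G * X = 0\<^sub>m m m}"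

definition orth :: "nat \<Rightarrow> 'a::field mat set" where
  "orth m = orth_G (1\<^sub>m m) m"

definition orth1 :: "nat \<Rightarrow> 'a::field mat set" where
  "orth1 m = lspan m {comm X Y | X Y. X \<in> orth m \<and> Y \<in> orth m}"

definition Pi_mat :: "nat \<Rightarrow> 'a::field mat" where
  "Pi_mat k = four_block_mat (0\<^sub>m k k) (1\<^sub>m k) (1\<^sub>m k) (0\<^sub>m k k)"

definition diag_block :: "'a::field mat \<Rightarrow> 'a mat \<Rightarrow> 'a mat" where
  "diag_block B1 B2 = four_block_mat B1 (0\<^sub>m (dim_row B1) (dim_col B2))
                          (0\<^sub>m (dim_row B2) (dim_col B1)) B2"

record ('a, 'v) lsa =
  ev  :: "'v set"
  od  :: "'v set"
  add :: "'v \<Rightarrow> 'v \<Rightarrow> 'v"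
  smul :: "'a \<Rightarrow> 'v \<Rightarrow> 'v"
  br  :: "'v \<Rightarrow> 'v \<Rightarrow> 'v"
  sq  :: "'v \<Rightarrow> 'v"

text \<open>An isomorphism of Lie superalgebras is an even linear bijection preserving brackets and
  squares; being even, it is given by its restrictions to the even and odd parts.
  (Brackets of two odd elements are determined by squaring via polarisation.)\<close>
definition lin_on :: "('a, 'v) lsa \<Rightarrow> ('a, 'w) lsa \<Rightarrow> 'v set \<Rightarrow> ('v \<Rightarrow> 'w) \<Rightarrow> bool" where
  "lin_on L M V f \<longleftrightarrow>
     (\<forall>x\<in>V. \<forall>y\<in>V. f (add L x y) = add M (f x) (f y)) \<and>
     (\<forall>c. \<forall>x\<in>V. f (smul L c x) = smul M c (f x))"

definition lsa_isomorphic :: "('a, 'v) lsa \<Rightarrow> ('a, 'w) lsa \<Rightarrow> bool" where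
  "lsa_isomorphic L M \<longleftrightarrow> (\<exists>f0 f1.
     bij_betw f0 (ev L) (ev M) \<and> bij_betw f1 (od L) (od M) \<and>
     lin_on L M (ev L) f0 \<and> lin_on L M (od L) f1 \<and>
     (\<forall>a\<in>ev L. \<forall>b\<in>ev L. f0 (br L a b) = br M (f0 a) (f0 b)) \<and>
     (\<forall>a\<in>ev L. \<forall>x\<in>od L. f1 (br L a x) = br M (f0 a) (f1 x)) \<and>
     (\<forall>x\<in>od L. \<forall>y\<in>od L. f0 (br L x y) = br M (f1 x) (f1 y)) \<and>
     (\<forall>x\<in>od L. f0 (sq L x) = sq M (f1 x)))"

definition even_smat :: "nat \<Rightarrow> nat \<Rightarrow> 'a::zero mat \<Rightarrow> bool" where
  "even_smat a b X \<longleftrightarrow> X \<in> carrier_mat (a+b) (a+b) \<and>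
     (\<forall>i<a+b. \<forall>j<a+b. (i < a) \<noteq> (j < a) \<longrightarrow> X $$ (i,j) = 0)"

definition odd_smat :: "nat \<Rightarrow> nat \<Rightarrow> 'a::zero mat \<Rightarrow> bool" where
  "odd_smat a b X \<longleftrightarrow> X \<in> carrier_mat (a+b) (a+b) \<and>
     (\<forall>i<a+b. \<forall>j<a+b. (i < a) = (j < a) \<longrightarrow> X $$ (i,j) = 0)"

definition oo_ev :: "'a::field mat \<Rightarrow> 'a mat \<Rightarrow> nat \<Rightarrow> nat \<Rightarrow> 'a mat set" where
  "oo_ev B1 B2 a b = {X \<in> orth_G (diag_block B1 B2) (a+b). even_smat a b X}"

definition oo_od :: "'a::field mat \<Rightarrow> 'a mat \<Rightarrow> nat \<Rightarrow> nat \<Rightarrow> 'a mat set" where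
  "oo_od B1 B2 a b = {X \<in> orth_G (diag_block B1 B2) (a+b). odd_smat a b X}"

definition oo1 :: "'a::field mat \<Rightarrow> 'a mat \<Rightarrow> nat \<Rightarrow> nat \<Rightarrow> ('a, 'a mat) lsa" where
  "oo1 B1 B2 a b =
    (let Ev = oo_ev B1 B2 a b; Od = oo_od B1 B2 a b in
     \<lparr> ev = lspan (a+b) ({comm X Y | X Y. X \<in> Ev \<and> Y \<in> Ev} \<union> {comm X Y | X Y. X \<in> Od \<and> Y \<in> Od}
                         \<union> {X * X | X. X \<in> Od}),
       od = lspan (a+b) {comm X Y | X Y. X \<in> Ev \<and> Y \<in> Od},
       add = (+), smul = (\<cdot>\<^sub>m), br = comm, sq = (\<lambda>X. X * X) \<rparr>)"

definition is_subspace :: "nat \<Rightarrow> 'a::field mat set \<Rightarrow> bool" where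
  "is_subspace N V \<longleftrightarrow> 0\<^sub>m N N \<in> V \<and> (\<forall>x\<in>V. \<forall>y\<in>V. x + y \<in> V) \<and> (\<forall>c. \<forall>x\<in>V. c \<cdot>\<^sub>m x \<in> V)"

definition is_Z2_grading :: "nat \<Rightarrow> 'a::field mat set \<Rightarrow> 'a mat set \<Rightarrow> 'a mat set \<Rightarrow> bool" where
  "is_Z2_grading N g g0 g1 \<longleftrightarrow>
     is_subspace N g0 \<and> is_subspace N g1 \<and> g0 \<subseteq> g \<and> g1 \<subseteq> g \<and>
     g0 \<inter> g1 = {0\<^sub>m N N} \<and> (\<forall>x\<in>g. \<exists>u\<in>g0. \<exists>v\<in>g1. x = u + v) \<and>
     (\<forall>x\<in>g0. \<forall>y\<in>g0. comm x y \<in> g0) \<and>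
     (\<forall>x\<in>g0. \<forall>y\<in>g1. comm x y \<in> g1) \<and>
     (\<forall>x\<in>g1. \<forall>y\<in>g0. comm x y \<in> g1) \<and>
     (\<forall>x\<in>g1. \<forall>y\<in>g1. comm x y \<in> g0)"

definition is_derivation :: "'a::field mat set \<Rightarrow> ('a mat \<Rightarrow> 'a mat) \<Rightarrow> bool" where
  "is_derivation g D \<longleftrightarrow> (\<forall>x\<in>g. D x \<in> g) \<and>
     (\<forall>x\<in>g. \<forall>y\<in>g. D (x + y) = D x + D y) \<and> (\<forall>c. \<forall>x\<in>g. D (c \<cdot>\<^sub>m x) = c \<cdot>\<^sub>m D x) \<and>
     (\<forall>x\<in>g. \<forall>y\<in>g. D (comm x y) = comm (D x) y + comm x (D y))"

text \<open>Endomorphisms of \<open>g\<close> are represented by functions that vanish (are \<open>0\<close>) outside \<open>g\<close>.\<close>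
definition ad_on :: "nat \<Rightarrow> 'a::field mat set \<Rightarrow> 'a mat \<Rightarrow> 'a mat \<Rightarrow> 'a mat" where
  "ad_on N g x = (\<lambda>y. if y \<in> g then comm x y else 0\<^sub>m N N)"

definition dcomm :: "('a::field mat \<Rightarrow> 'a mat) \<Rightarrow> ('a mat \<Rightarrow> 'a mat) \<Rightarrow> 'a mat \<Rightarrow> 'a mat" where
  "dcomm D E = (\<lambda>y. D (E y) - E (D y))"

inductive_set g_one :: "nat \<Rightarrow> 'a::field mat set \<Rightarrow> 'a mat set \<Rightarrow> ('a mat \<Rightarrow> 'a mat) set"
  for N g g1 where
  g_one_ad: "x \<in> g \<Longrightarrow> ad_on N g x \<in> g_one N g g1"
| g_one_sq: "x \<in> g1 \<Longrightarrow> ad_on N g x \<circ> ad_on N g x \<in> g_one N g g1"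
| g_one_zero: "(\<lambda>y. 0\<^sub>m N N) \<in> g_one N g g1"
| g_one_add: "D \<in> g_one N g g1 \<Longrightarrow> E \<in> g_one N g g1 \<Longrightarrow> (\<lambda>y. D y + E y) \<in> g_one N g g1"
| g_one_smult: "D \<in> g_one N g g1 \<Longrightarrow> (\<lambda>y. c \<cdot>\<^sub>m D y) \<in> g_one N g g1"
| g_one_br: "D \<in> g_one N g g1 \<Longrightarrow> E \<in> g_one N g g1 \<Longrightarrow> dcomm D E \<in> g_one N g g1"

definition S_g_one :: "nat \<Rightarrow> 'a::field mat set \<Rightarrow> 'a mat set \<Rightarrow> 'a mat set
                         \<Rightarrow> ('a, 'a mat \<Rightarrow> 'a mat) lsa" where
  "S_g_one N g g0 g1 =
    \<lparr> ev = {D \<in> g_one N g g1. D ` g0 \<subseteq> g0 \<and> D ` g1 \<subseteq> g1},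
      od = {D \<in> g_one N g g1. D ` g0 \<subseteq> g1 \<and> D ` g1 \<subseteq> g0},
      add = (\<lambda>D E y. D y + E y), smul = (\<lambda>c D y. c \<cdot>\<^sub>m D y), br = dcomm,
      sq = (\<lambda>D. D \<circ> D) \<rparr>"

end

theory Submission
  imports Defs "Jordan_Normal_Form.Determinant"
begin

text \<open>
  In characteristic 2 the algebra \<open>orth1 N\<close>, \<open>N\<close> odd, consists of the alternating matrices, and a
  \<open>\<int>/2\<close>-grading is the eigenspace decomposition of a derivation \<open>D\<close> with \<open>D\<^sup>2 = D\<close>. If \<open>D = ad A\<close>
  with \<open>A\<close> symmetric, then \<open>A\<^sup>2 + A\<close> centralises the alternating matrices, hence is a scalar, and adding a
  suitable scalar to \<open>A\<close> makes it idempotent. Thus \<open>A\<close> is an orthogonal projection and the grading comes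
  from an orthogonal decomposition of the column space. A nondegenerate symmetric form on each summand
  has an orthonormal or (if it is alternating) a symplectic basis; conjugation with these bases turns
  the even and odd symmetric matrices into those of \<open>oo\<close>. The extension by the squares of odd elements is
  \<open>ad\<close> of the derived superalgebra, and \<open>ad\<close> is injective on it because its matrices have trace 0, while
  a nonzero scalar matrix of odd size has nonzero trace.
\<close>

text \<open>S(g^<1>) consists of operators and oo^(1) of supermatrices in another basis, so they are
  not compared directly. Both receive an isomorphism from one superalgebra of plain matrices
  attached to the idempotent \<open>A\<close>: \<open>ad\<close> leads to the former, conjugation
  with an adapted basis to the latter. The square of an odd alternating matrix is symmetric but may
  have a nonzero diagonal, so the even part of this superalgebra can exceed the even part of g; this
  surplus is what g^<1> adds to ad g. The idempotent belonging to a grading is unique only up to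
  exchanging \<open>A\<close> and 1 + \<open>A\<close>, because t^2 + t = 0 leaves t = 0 and t = 1.
  Algebraic closedness enters twice: through square roots, which normalise vectors of nonzero norm,
  and through solutions of t^2 + t = c, which turn a matrix inducing the grading into an idempotent
  one.\<close>

text \<open>One isomorphism is composed with the inverse of the other. Since
  \<open>lsa_isomorphic\<close> speaks only about elements of the carriers, inverting
  \<open>f0\<close> and \<open>f1\<close> on a result of an operation requires that the operations
  of \<open>K\<close> stay inside its carriers.\<close>

lemma lsa_isomorphic_common_source:
  fixes K :: "('a, 'u) lsa" and L :: "('a, 'v) lsa" and M :: "('a, 'w) lsa"
  assumes KL: "lsa_isomorphic K L" and KM: "lsa_isomorphic K M"
    and closed: "\<And>x y. x \<in> ev K \<Longrightarrow> y \<in> ev K \<Longrightarrow> add K x y \<in> ev K"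
      "\<And>x y. x \<in> od K \<Longrightarrow> y \<in> od K \<Longrightarrow> add K x y \<in> od K"
      "\<And>c x. x \<in> ev K \<Longrightarrow> smul K c x \<in> ev K" "\<And>c x. x \<in> od K \<Longrightarrow> smul K c x \<in> od K"
      "\<And>x y. x \<in> ev K \<Longrightarrow> y \<in> ev K \<Longrightarrow> br K x y \<in> ev K"
      "\<And>x y. x \<in> ev K \<Longrightarrow> y \<in> od K \<Longrightarrow> br K x y \<in> od K"
      "\<And>x y. x \<in> od K \<Longrightarrow> y \<in> od K \<Longrightarrow> br K x y \<in> ev K"
      "\<And>x. x \<in> od K \<Longrightarrow> sq K x \<in> ev K"
  shows "lsa_isomorphic L M"
proof -
  obtain f0 f1 where f: "bij_betw f0 (ev K) (ev L)" "bij_betw f1 (od K) (od L)"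
    "lin_on K L (ev K) f0" "lin_on K L (od K) f1"
    "\<forall>a\<in>ev K. \<forall>b\<in>ev K. f0 (br K a b) = br L (f0 a) (f0 b)"
    "\<forall>a\<in>ev K. \<forall>x\<in>od K. f1 (br K a x) = br L (f0 a) (f1 x)"
    "\<forall>x\<in>od K. \<forall>y\<in>od K. f0 (br K x y) = br L (f1 x) (f1 y)"
    "\<forall>x\<in>od K. f0 (sq K x) = sq L (f1 x)"
    using KL unfolding lsa_isomorphic_def by blast
  obtain g0 g1 where g: "bij_betw g0 (ev K) (ev M)" "bij_betw g1 (od K) (od M)"
    "lin_on K M (ev K) g0" "lin_on K M (od K) g1"
    "\<forall>a\<in>ev K. \<forall>b\<in>ev K. g0 (br K a b) = br M (g0 a) (g0 b)"
    "\<forall>a\<in>ev K. \<forall>x\<in>od K. g1 (br K a x) = br M (g0 a) (g1 x)"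
    "\<forall>x\<in>od K. \<forall>y\<in>od K. g0 (br K x y) = br M (g1 x) (g1 y)"
    "\<forall>x\<in>od K. g0 (sq K x) = sq M (g1 x)"
    using KM unfolding lsa_isomorphic_def by blast
  define h0 where "h0 = g0 \<circ> the_inv_into (ev K) f0"
  define h1 where "h1 = g1 \<circ> the_inv_into (od K) f1"
  have h0f [simp]: "h0 (f0 x) = g0 x" if "x \<in> ev K" for x
    using that f(1) by (simp add: h0_def the_inv_into_f_f bij_betw_def)
  have h1f [simp]: "h1 (f1 x) = g1 x" if "x \<in> od K" for x
    using that f(2) by (simp add: h1_def the_inv_into_f_f bij_betw_def)
  have L: "ev L = f0 ` ev K" "od L = f1 ` od K" using f(1,2) by (simp_all add: bij_betw_def)
  have lin0: "add L (f0 x) (f0 y) = f0 (add K x y)" "smul L c (f0 x) = f0 (smul K c x)"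
    if "x \<in> ev K" "y \<in> ev K" for x y c using f(3) that by (auto simp: lin_on_def)
  have lin1: "add L (f1 x) (f1 y) = f1 (add K x y)" "smul L c (f1 x) = f1 (smul K c x)"
    if "x \<in> od K" "y \<in> od K" for x y c using f(4) that by (auto simp: lin_on_def)
  show ?thesis
    unfolding lsa_isomorphic_def
  proof (rule exI[of _ h0], rule exI[of _ h1], intro conjI)
    show "bij_betw h0 (ev L) (ev M)" unfolding h0_def
      by (rule bij_betw_trans[OF bij_betw_the_inv_into[OF f(1)] g(1)])
    show "bij_betw h1 (od L) (od M)" unfolding h1_def
      by (rule bij_betw_trans[OF bij_betw_the_inv_into[OF f(2)] g(2)])
    show "lin_on L M (ev L) h0" using g(3) by (auto simp: lin_on_def L lin0 closed)
    show "lin_on L M (od L) h1" using g(4) by (auto simp: lin_on_def L lin1 closed)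
    show "\<forall>a\<in>ev L. \<forall>b\<in>ev L. h0 (br L a b) = br M (h0 a) (h0 b)"
      using g(5) by (auto simp: L f(5)[rule_format, symmetric] closed)
    show "\<forall>a\<in>ev L. \<forall>x\<in>od L. h1 (br L a x) = br M (h0 a) (h1 x)"
      using g(6) by (auto simp: L f(6)[rule_format, symmetric] closed)
    show "\<forall>x\<in>od L. \<forall>y\<in>od L. h0 (br L x y) = br M (h1 x) (h1 y)"
      using g(7) by (auto simp: L f(7)[rule_format, symmetric] closed)
    show "\<forall>x\<in>od L. h0 (sq L x) = sq M (h1 x)"
      using g(8) by (auto simp: L f(8)[rule_format, symmetric] closed)
  qed
qed

section \<open>Dimension bound and block Gram matrices\<close>

text \<open>If N < r, both factors can be padded with zeros to square matrices of size r without
  changing the product. A one-sided inverse of a square matrix is two-sided, but row N of the padded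
  \<open>Y\<close> vanishes.\<close>

lemma mult_eq_one_dim_le:
  fixes X Y :: "'a::field mat"
  assumes X: "X \<in> carrier_mat r N" and Y: "Y \<in> carrier_mat N r" and XY: "X * Y = 1\<^sub>m r"
  shows "r \<le> N"
proof (rule ccontr)
  assume "\<not> r \<le> N"
  then have lt: "N < r" by simp
  define X' where "X' = mat r r (\<lambda>(i,j). if j < N then X $$ (i,j) else 0)"
  define Y' where "Y' = mat r r (\<lambda>(i,j). if i < N then Y $$ (i,j) else 0)"
  have "X' * Y' = X * Y"
  proof (rule eq_matI)
    fix i j assume "i < dim_row (X * Y)" "j < dim_col (X * Y)"
    then have ij: "i < r" "j < r" using X Y by auto
    have "(X' * Y') $$ (i,j) = (\<Sum>k = 0..<r. if k < N then X $$ (i,k) * Y $$ (k,j) else 0)"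
      using ij by (auto simp: X'_def Y'_def scalar_prod_def intro!: sum.cong)
    also have "\<dots> = (\<Sum>k = 0..<N. X $$ (i,k) * Y $$ (k,j))"
      using lt by (intro sum.mono_neutral_cong_right) auto
    also have "\<dots> = (X * Y) $$ (i,j)" using X Y ij by (simp add: scalar_prod_def)
    finally show "(X' * Y') $$ (i,j) = (X * Y) $$ (i,j)" .
  qed (use X Y in \<open>auto simp: X'_def Y'_def\<close>)
  then have "Y' * X' = 1\<^sub>m r"
    using XY by (intro mat_mult_left_right_inverse[of X' r Y']) (auto simp: X'_def Y'_def)
  then have "(Y' * X') $$ (N,N) = 1" using lt by simp
  moreover have "(Y' * X') $$ (N,N) = 0" using lt by (auto simp: X'_def Y'_def scalar_prod_def intro!: sum.neutral)
  ultimately show False by simp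
qed

lemma Pi_mat_carrier [simp]: "Pi_mat k \<in> carrier_mat (2 * k) (2 * k)"
  unfolding Pi_mat_def mult_2 by (rule four_block_carrier_mat) auto

lemma Pi_mat_dim [simp]: "dim_row (Pi_mat k) = 2 * k" "dim_col (Pi_mat k) = 2 * k"
  using Pi_mat_carrier by (rule carrier_matD)+

lemma Pi_mat_index: "i < 2 * k \<Longrightarrow> j < 2 * k \<Longrightarrow>
  Pi_mat k $$ (i,j) = (if i < k then if j = i + k then 1 else 0 else if i = j + k then 1 else 0)"
  unfolding Pi_mat_def by (auto simp: four_block_mat_def Let_def)

lemma Pi_mat_sq: "Pi_mat k * Pi_mat k = 1\<^sub>m (2 * k)"
  unfolding Pi_mat_def
  by (subst mult_four_block_mat[where ?nr1.0 = k and ?n1.0 = k and ?n2.0 = k and ?nr2.0 = k and ?nc1.0 = k and ?nc2.0 = k])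
    (auto simp: four_block_mat_def Let_def intro!: eq_matI)

lemma Pi_mat_transpose: "transpose_mat (Pi_mat k) = Pi_mat k"
  by (intro eq_matI) (auto simp: Pi_mat_index)

lemma transpose_diag_block:
  assumes "B1 \<in> carrier_mat a a" "B2 \<in> carrier_mat b b" "transpose_mat B1 = B1" "transpose_mat B2 = B2"
  shows "transpose_mat (diag_block B1 B2) = diag_block B1 B2"
  using assms transpose_four_block_mat[OF assms(1) zero_carrier_mat[of a b] zero_carrier_mat[of b a] assms(2)]
  by (simp add: diag_block_def)

lemma diag_block_carrier:
  "B1 \<in> carrier_mat a a \<Longrightarrow> B2 \<in> carrier_mat b b \<Longrightarrow> diag_block B1 B2 \<in> carrier_mat (a + b) (a + b)"
  unfolding diag_block_def by (rule four_block_carrier_mat)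

lemma diag_block_sq:
  assumes "B1 \<in> carrier_mat a a" "B2 \<in> carrier_mat b b" "B1 * B1 = 1\<^sub>m a" "B2 * B2 = 1\<^sub>m b"
  shows "diag_block B1 B2 * diag_block B1 B2 = 1\<^sub>m (a + b)"
proof -
  have "diag_block B1 B2 * diag_block B1 B2 = four_block_mat (1\<^sub>m a) (0\<^sub>m a b) (0\<^sub>m b a) (1\<^sub>m b)"
    using assms mult_four_block_mat[of B1 a a "0\<^sub>m a b" b "0\<^sub>m b a" b B2 B1 a "0\<^sub>m a b" b "0\<^sub>m b a" B2]
    by (simp add: diag_block_def)
  then show ?thesis by (simp add: four_block_one_mat)
qed

lemma diag_block_index:
  assumes "B1 \<in> carrier_mat a a" "B2 \<in> carrier_mat b b" "i < a + b" "j < a + b"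
  shows "diag_block B1 B2 $$ (i,j) = (if i < a then if j < a then B1 $$ (i,j) else 0
    else if j < a then 0 else B2 $$ (i - a, j - a))"
  using assms by (auto simp: diag_block_def)

locale char2_mat =
  fixes N :: nat and ty :: "'a::field itself"
  assumes char2: "CHAR('a) = 2"
begin

subsection \<open>Matrices in characteristic 2\<close>

abbreviation M :: "'a mat set" where "M \<equiv> carrier_mat N N"

lemma add_self [simp]: "(x::'a) + x = 0"
proof -
  have "x + x = of_nat 2 * x" by (simp only: of_nat_numeral mult_2)
  also have "of_nat 2 = (0::'a)" using of_nat_CHAR[where ?'a = 'a] unfolding char2 .
  finally show ?thesis by simp
qed

lemma uminus_eq [simp]: "- (x::'a) = x"
  using add_self[of x] by (metis add_eq_0_iff)

lemma diff_eq_add: "(x::'a) - y = x + y"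
  by (metis uminus_eq diff_conv_add_uminus)

lemma minus_mat_eq_add: "(X::'a mat) - Y = X + Y"
  by (rule eq_matI) (auto simp: diff_eq_add)

lemma comm_eq: "comm X Y = X * Y + Y * (X::'a mat)"
  by (simp add: comm_def minus_mat_eq_add)

lemma madd_self: "X \<in> M \<Longrightarrow> X + X = 0\<^sub>m N N"
  by (rule eq_matI) auto

lemma madd_left_self: "X \<in> M \<Longrightarrow> Y \<in> M \<Longrightarrow> X + (X + Y) = Y"
  by (rule eq_matI) (auto simp: add.assoc[symmetric])

lemma mult_closed: "X \<in> M \<Longrightarrow> Y \<in> M \<Longrightarrow> X * Y \<in> M" by simp
lemma add_closed: "X \<in> M \<Longrightarrow> Y \<in> M \<Longrightarrow> X + Y \<in> M" by simp
lemma madd_comm: "X \<in> M \<Longrightarrow> Y \<in> M \<Longrightarrow> X + Y = Y + X" by (rule comm_add_mat)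
lemma madd_left_comm: "X \<in> M \<Longrightarrow> Y \<in> M \<Longrightarrow> Z \<in> M \<Longrightarrow> X + (Y + Z) = Y + (X + Z)"
  by (rule eq_matI) auto
lemma madd_assoc: "X \<in> M \<Longrightarrow> Y \<in> M \<Longrightarrow> Z \<in> M \<Longrightarrow> (X + Y) + Z = X + (Y + Z)"
  by (rule assoc_add_mat)
lemma mmult_assoc: "X \<in> M \<Longrightarrow> Y \<in> M \<Longrightarrow> Z \<in> M \<Longrightarrow> (X * Y) * Z = X * (Y * Z)"
  by (rule assoc_mult_mat)
lemma mdistrib_right: "X \<in> M \<Longrightarrow> Y \<in> M \<Longrightarrow> Z \<in> M \<Longrightarrow> (X + Y) * Z = X * Z + Y * Z"
  by (rule add_mult_distrib_mat)
lemma mdistrib_left: "X \<in> M \<Longrightarrow> Y \<in> M \<Longrightarrow> Z \<in> M \<Longrightarrow> X * (Y + Z) = X * Y + X * Z"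
  by (rule mult_add_distrib_mat)
lemma msmult_left: "X \<in> M \<Longrightarrow> Y \<in> M \<Longrightarrow> (c \<cdot>\<^sub>m X) * Y = c \<cdot>\<^sub>m (X * Y)"
  by (rule mult_smult_assoc_mat)
lemma msmult_right: "X \<in> M \<Longrightarrow> Y \<in> M \<Longrightarrow> X * (c \<cdot>\<^sub>m Y) = c \<cdot>\<^sub>m (X * Y)"
  by (rule mult_smult_distrib)
lemma msmult_add: "X \<in> M \<Longrightarrow> Y \<in> M \<Longrightarrow> c \<cdot>\<^sub>m (X + Y) = c \<cdot>\<^sub>m X + c \<cdot>\<^sub>m Y"
  by (rule add_smult_distrib_left_mat)
lemma msmult_add_scalar: "X \<in> M \<Longrightarrow> (c + d) \<cdot>\<^sub>m X = c \<cdot>\<^sub>m X + d \<cdot>\<^sub>m X"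
  by (rule add_smult_distrib_right_mat)
lemma mone: "X \<in> M \<Longrightarrow> X * 1\<^sub>m N = X" "X \<in> M \<Longrightarrow> 1\<^sub>m N * X = X" by auto
lemma mzero: "X \<in> M \<Longrightarrow> X * 0\<^sub>m N N = 0\<^sub>m N N" "X \<in> M \<Longrightarrow> 0\<^sub>m N N * X = 0\<^sub>m N N"
  "X \<in> M \<Longrightarrow> X + 0\<^sub>m N N = X" "X \<in> M \<Longrightarrow> 0\<^sub>m N N + X = X" by auto
lemma msmult_zero_one: "X \<in> M \<Longrightarrow> 0 \<cdot>\<^sub>m X = 0\<^sub>m N N" "(1::'a) \<cdot>\<^sub>m X = X"
  by (rule eq_matI; simp)+
lemma mtransp: "X \<in> M \<Longrightarrow> Y \<in> M \<Longrightarrow> transpose_mat (X + Y) = transpose_mat X + transpose_mat Y"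
  "X \<in> M \<Longrightarrow> Y \<in> M \<Longrightarrow> transpose_mat (X * Y) = transpose_mat Y * transpose_mat X"
  "X \<in> M \<Longrightarrow> transpose_mat (c \<cdot>\<^sub>m X) = c \<cdot>\<^sub>m transpose_mat X"
  by (auto simp: transpose_add transpose_mult)

text \<open>Distributivity, ordered rewriting and cancellation of equal summands together decide
  identities of noncommutative polynomials over a ring of characteristic 2.\<close>
lemmas mring = mult_closed add_closed smult_carrier_mat zero_carrier_mat one_carrier_mat
  madd_self madd_left_self madd_comm madd_left_comm madd_assoc mmult_assoc
  mdistrib_left mdistrib_right msmult_left msmult_right msmult_add mone mzero

lemma madd_eq_zero_iff: "X \<in> M \<Longrightarrow> Y \<in> M \<Longrightarrow> X + Y = 0\<^sub>m N N \<longleftrightarrow> X = Y"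
  by (metis madd_self madd_left_self mzero(3))

section \<open>Symmetric and alternating matrices, even and odd elements\<close>

text \<open>This is o(N): without signs, the condition X^T + X = 0 says that X is symmetric.\<close>

definition Sym :: "'a mat set" where "Sym = {X \<in> M. transpose_mat X = X}"
definition Alt :: "'a mat set" where "Alt = {X \<in> Sym. \<forall>i<N. X $$ (i,i) = 0}"
text \<open>For a symmetric idempotent \<open>A\<close>, these are the eigenspaces of \<open>ad A\<close> for the eigenvalues 0 and 1.\<close>
definition Ev :: "'a mat \<Rightarrow> 'a mat set" where "Ev A = {X \<in> Sym. A * X = X * A}"
definition Od :: "'a mat \<Rightarrow> 'a mat set" where "Od A = {X \<in> Sym. A * X + X * A = X}"

lemma SymD: "X \<in> Sym \<Longrightarrow> X \<in> M" "X \<in> Sym \<Longrightarrow> transpose_mat X = X" by (auto simp: Sym_def)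
lemma AltD: "X \<in> Alt \<Longrightarrow> X \<in> Sym" "X \<in> Alt \<Longrightarrow> X \<in> M" by (auto simp: Alt_def Sym_def)
lemma EvD: "X \<in> Ev A \<Longrightarrow> X \<in> Sym" "X \<in> Ev A \<Longrightarrow> X \<in> M" "X \<in> Ev A \<Longrightarrow> A * X = X * A"
  by (auto simp: Ev_def Sym_def)
lemma OdD: "X \<in> Od A \<Longrightarrow> X \<in> Sym" "X \<in> Od A \<Longrightarrow> X \<in> M" "X \<in> Od A \<Longrightarrow> A * X + X * A = X"
  by (auto simp: Od_def Sym_def)

lemma orth_eq_Sym: "orth N = Sym"
  unfolding orth_def orth_G_def Sym_def
  by (auto simp: madd_eq_zero_iff)

lemma lspan_carrier: "S \<subseteq> M \<Longrightarrow> X \<in> lspan N S \<Longrightarrow> X \<in> M"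
  by (erule lspan.induct) auto

lemma lspan_least:
  assumes "is_subspace N V" "S \<subseteq> V" shows "lspan N S \<subseteq> V"
proof
  fix x assume "x \<in> lspan N S"
  then show "x \<in> V" using assms by (induction) (auto simp: is_subspace_def)
qed

lemma subspace_lspan: "is_subspace N (lspan N S)"
  by (auto simp: is_subspace_def intro: lspan.intros)

lemma comm_carrier [simp]: "X \<in> M \<Longrightarrow> Y \<in> M \<Longrightarrow> comm X Y \<in> M"
  by (simp add: comm_eq)

lemma subspaceD:
  assumes "is_subspace N V"
  shows "0\<^sub>m N N \<in> V" "x \<in> V \<Longrightarrow> y \<in> V \<Longrightarrow> x + y \<in> V" "x \<in> V \<Longrightarrow> c \<cdot>\<^sub>m x \<in> V"
  using assms by (auto simp: is_subspace_def)

lemma subspace_Sym: "is_subspace N Sym"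
  by (auto simp: is_subspace_def Sym_def mtransp)

lemma subspace_Alt: "is_subspace N Alt"
  using subspace_Sym by (auto simp: is_subspace_def Alt_def dest: SymD)

lemma subspace_Ev: "A \<in> M \<Longrightarrow> is_subspace N (Ev A)"
  using subspace_Sym unfolding is_subspace_def Ev_def
  by (auto simp: mdistrib_left mdistrib_right msmult_left msmult_right SymD)

lemma subspace_Od: "A \<in> M \<Longrightarrow> is_subspace N (Od A)"
  unfolding is_subspace_def
proof (intro conjI ballI allI)
  assume A: "A \<in> M"
  show "0\<^sub>m N N \<in> Od A" using A subspaceD(1)[OF subspace_Sym] by (simp add: Od_def)
  fix x y c assume x: "x \<in> Od A"
  note [simp] = OdD(2)[OF x]
  have "A * (c \<cdot>\<^sub>m x) + (c \<cdot>\<^sub>m x) * A = c \<cdot>\<^sub>m (A * x + x * A)"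
    using A by (simp add: mring)
  then show "c \<cdot>\<^sub>m x \<in> Od A"
    using A subspaceD(3)[OF subspace_Sym] OdD[OF x] by (simp add: Od_def)
  assume y: "y \<in> Od A"
  note [simp] = OdD(2)[OF y]
  have "A * (x + y) + (x + y) * A = (A * x + x * A) + (A * y + y * A)"
    using A by (simp add: mring)
  then show "x + y \<in> Od A"
    using A subspaceD(2)[OF subspace_Sym] OdD[OF x] OdD[OF y] by (simp add: Od_def)
qed

lemma add_transpose_Alt: "X \<in> M \<Longrightarrow> X + transpose_mat X \<in> Alt"
  by (auto simp: Alt_def Sym_def mtransp madd_comm)

text \<open>For symmetric factors \<open>Y * X\<close> is the transpose of \<open>X * Y\<close>, so
  the bracket has the form Z + Z^T, and its diagonal is twice that of Z.\<close>

lemma comm_Sym_Alt: assumes "X \<in> Sym" "Y \<in> Sym" shows "comm X Y \<in> Alt"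
  using add_transpose_Alt[of "X * Y"] SymD[OF assms(1)] SymD[OF assms(2)] by (simp add: comm_eq mtransp)

text \<open>An odd element equals its own bracket with the symmetric matrix
  \<open>A\<close>.\<close>

lemma Od_Alt: assumes "A \<in> Sym" shows "Od A \<subseteq> Alt"
proof
  fix X assume X: "X \<in> Od A"
  then have "comm A X \<in> Alt" using assms by (intro comm_Sym_Alt) (auto dest: OdD)
  then show "X \<in> Alt" using OdD(3)[OF X] by (simp add: comm_eq)
qed

section \<open>Rank-one matrices\<close>

definition outer :: "'a vec \<Rightarrow> 'a vec \<Rightarrow> 'a mat" where
  "outer v w = mat N N (\<lambda>(i,j). v $ i * w $ j)"

lemma outer_carrier [simp]: "outer v w \<in> M" by (simp add: outer_def)

lemma outer_transpose [simp]: "transpose_mat (outer v w) = outer w v"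
  by (rule eq_matI) (auto simp: outer_def)

lemma outer_mult: "u \<in> carrier_vec N \<Longrightarrow> w \<in> carrier_vec N \<Longrightarrow>
  outer v w * outer u x = (w \<bullet> u) \<cdot>\<^sub>m outer v x"
  by (rule eq_matI) (auto simp: outer_def scalar_prod_def sum_distrib_left ac_simps)

lemma mult_outer: "X \<in> M \<Longrightarrow> v \<in> carrier_vec N \<Longrightarrow> X * outer v w = outer (X *\<^sub>v v) w"
  by (rule eq_matI) (auto simp: outer_def scalar_prod_def sum_distrib_left sum_distrib_right ac_simps)

lemma outer_mult_mat: assumes "X \<in> M" "w \<in> carrier_vec N"
  shows "outer v w * X = outer v (transpose_mat X *\<^sub>v w)"
proof -
  have "outer v w * X = transpose_mat (transpose_mat X * outer w v)"
    using assms by (simp add: mtransp)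
  then show ?thesis using assms by (simp add: mult_outer)
qed

lemma outer_zero: "outer v (0\<^sub>v N) = 0\<^sub>m N N" "outer (0\<^sub>v N) v = 0\<^sub>m N N"
  by (rule eq_matI; simp add: outer_def)+

subsection \<open>Alternating matrices\<close>

lemma Sym_scalar_prod:
  assumes "X \<in> Sym" "v \<in> carrier_vec N" "w \<in> carrier_vec N"
  shows "(X *\<^sub>v v) \<bullet> w = v \<bullet> (X *\<^sub>v w)"
  using transpose_vec_mult_scalar[of X N N w v] assms by (simp add: Sym_def)

lemma outer_self_Ev: assumes "A \<in> Sym" "v \<in> carrier_vec N" "A *\<^sub>v v = v" shows "outer v v \<in> Ev A"
  using assms by (simp add: Ev_def Sym_def mult_outer outer_mult_mat)

lemma wedge_Ev:
  assumes "A \<in> Sym" "v \<in> carrier_vec N" "w \<in> carrier_vec N" "A *\<^sub>v v = v" "A *\<^sub>v w = w"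
  shows "outer v w + outer w v \<in> Ev A"
  using assms by (simp add: Ev_def Sym_def mult_outer outer_mult_mat mring mtransp)

text \<open>If \<open>v\<close> and \<open>w\<close> are orthogonal, one brackets \<open>v u\<^sup>T + u v\<^sup>T\<close> with \<open>w w\<^sup>T\<close>,
  where \<open>u\<close> is a vector of the image of \<open>A\<close> with \<open>u \<bullet> w = 1\<close>.\<close>
lemma wedge_in_span:
  assumes A: "A \<in> Sym" and idem: "A * A = A" and v: "v \<in> carrier_vec N" "A *\<^sub>v v = v" and w: "w \<in> carrier_vec N" "A *\<^sub>v w = w"
  shows "outer v w + outer w v \<in> lspan N {comm X Y |X Y. X \<in> Ev A \<and> Y \<in> Ev A}" (is "_ \<in> lspan N ?S")
proof (cases "v \<bullet> w = 0")
  case False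
  have "comm (outer v v) (outer w w) = (v \<bullet> w) \<cdot>\<^sub>m (outer v w + outer w v)"
    using v w by (simp add: comm_eq outer_mult comm_scalar_prod[OF w(1) v(1)] msmult_add)
  then have "outer v w + outer w v = (1 / (v \<bullet> w)) \<cdot>\<^sub>m comm (outer v v) (outer w w)"
    using False by (intro eq_matI) simp_all
  moreover have "comm (outer v v) (outer w w) \<in> ?S"
    using outer_self_Ev[OF A v] outer_self_Ev[OF A w] by blast
  ultimately show ?thesis by (simp only: lspan_smult[OF lspan_gen])
next
  case vw: True
  show ?thesis
  proof (cases "w = 0\<^sub>v N")
    case True
    then show ?thesis by (simp add: outer_zero lspan_zero)
  next
    case False
    then obtain i where i: "i < N" "w $ i \<noteq> 0"
      using w(1) by (metis carrier_vecD eq_vecI index_zero_vec)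
    define u where "u = (1 / w $ i) \<cdot>\<^sub>v (A *\<^sub>v unit_vec N i)"
    have AM: "A \<in> M" using A by (rule SymD)
    have e: "unit_vec N i \<in> carrier_vec N" by simp
    have Ae: "A *\<^sub>v unit_vec N i \<in> carrier_vec N" using AM by simp
    have u: "u \<in> carrier_vec N" using Ae by (simp add: u_def)
    have uw: "u \<bullet> w = 1"
      using i Ae w Sym_scalar_prod[OF A e w(1)] by (simp add: u_def)
    have Au: "A *\<^sub>v u = u"
      unfolding u_def mult_mat_vec[OF AM Ae] assoc_mult_mat_vec[OF AM AM e, symmetric] idem ..
    have "comm (outer v u + outer u v) (outer w w) = outer v w + outer w v"
      using u v w vw uw comm_scalar_prod[OF w(1) v(1)] comm_scalar_prod[OF w(1) u]
      by (simp add: comm_eq outer_mult mdistrib_left mdistrib_right mzero msmult_zero_one)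
    moreover have "comm (outer v u + outer u v) (outer w w) \<in> ?S"
      using wedge_Ev[OF A v(1) u v(2) Au] outer_self_Ev[OF A w] by blast
    ultimately show ?thesis by (simp only: lspan_gen)
  qed
qed

text \<open>For \<open>i \<noteq> j\<close> these are the elementary alternating matrices; for
  \<open>i = j\<close> the two summands cancel, so no condition on the indices is needed for
  membership in \<open>Alt\<close>.\<close>

definition E_pair :: "nat \<Rightarrow> nat \<Rightarrow> 'a mat" where
  "E_pair i j = outer (unit_vec N i) (unit_vec N j) + outer (unit_vec N j) (unit_vec N i)"

lemma E_pair_carrier [simp]: "E_pair i j \<in> M" by (simp add: E_pair_def)

lemma E_pair_index_aux: "i < N \<Longrightarrow> j < N \<Longrightarrow> r < N \<Longrightarrow> s < N \<Longrightarrow>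
  E_pair i j $$ (r,s) = unit_vec N i $ r * unit_vec N j $ s + unit_vec N j $ r * unit_vec N i $ s"
  by (simp add: E_pair_def outer_def del: index_unit_vec)

lemma indicator_mult: "(if P then (1::'a) else 0) * (if Q then 1 else 0) = (if P \<and> Q then 1 else 0)"
  by simp

lemma E_pair_index: "i < N \<Longrightarrow> j < N \<Longrightarrow> r < N \<Longrightarrow> s < N \<Longrightarrow>
  E_pair i j $$ (r,s) = (if r = i \<and> s = j then 1 else 0) + (if r = j \<and> s = i then 1 else 0)"
  by (simp only: E_pair_index_aux index_unit_vec(1) indicator_mult)

lemma E_pair_Alt: "E_pair i j \<in> Alt"
  using add_transpose_Alt[of "outer (unit_vec N i) (unit_vec N j)"] by (simp add: E_pair_def)

lemma Sym_index: assumes "X \<in> Sym" "i < N" "j < N" shows "X $$ (i,j) = X $$ (j,i)"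
  using SymD[OF assms(1)] assms(2,3) by (metis carrier_matD index_transpose_mat(1))

text \<open>Induction on the number of nonzero entries. Such an entry lies off the diagonal, and by
  symmetry one multiple of \<open>E_pair i j\<close> clears it together with its mirror
  image.\<close>

lemma Alt_subset_span: "Alt \<subseteq> lspan N {E_pair i j |i j. i < N \<and> j < N}" (is "_ \<subseteq> ?L")
proof
  fix X assume "X \<in> Alt"
  then show "X \<in> ?L"
  proof (induction "card {p. fst p < N \<and> snd p < N \<and> X $$ p \<noteq> 0}" arbitrary: X rule: less_induct)
    case less
    let ?supp = "\<lambda>X::'a mat. {p. fst p < N \<and> snd p < N \<and> X $$ p \<noteq> 0}"
    have fin: "finite (?supp Y)" for Y
      by (rule finite_subset[of _ "{..<N} \<times> {..<N}"]) auto
    have X: "X \<in> Sym" "X \<in> M" using less.prems by (auto dest: AltD)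
    show ?case
    proof (cases "?supp X = {}")
      case True
      then have "X = 0\<^sub>m N N" using X by (intro eq_matI) auto
      then show ?thesis by (simp add: lspan_zero)
    next
      case False
      then obtain i j where ij: "i < N" "j < N" "X $$ (i,j) \<noteq> 0" by auto
      then have ne: "i \<noteq> j" using less.prems by (auto simp: Alt_def)
      define Y where "Y = X + X $$ (i,j) \<cdot>\<^sub>m E_pair i j"
      have Y: "Y \<in> Alt" unfolding Y_def
        using subspaceD[OF subspace_Alt] less.prems E_pair_Alt by blast
      have idx: "Y $$ (r,s) = X $$ (r,s) + X $$ (i,j) * E_pair i j $$ (r,s)" if "r < N" "s < N" for r s
        using that X carrier_matD[OF E_pair_carrier] by (auto simp: Y_def)
      have "?supp Y \<subset> ?supp X"
      proof
        show "?supp Y \<subseteq> ?supp X"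
          using ij ne Sym_index[OF X(1) ij(1,2)] by (auto simp: idx E_pair_index split: if_splits)
        have "(i,j) \<in> ?supp X" "(i,j) \<notin> ?supp Y" using ij ne by (auto simp: idx E_pair_index)
        then show "?supp Y \<noteq> ?supp X" by blast
      qed
      then have "Y \<in> ?L" by (intro less.hyps Y psubset_card_mono fin)
      moreover have "E_pair i j \<in> ?L" using ij by (intro lspan_gen) blast
      ultimately have "Y + X $$ (i,j) \<cdot>\<^sub>m E_pair i j \<in> ?L" by (intro lspan_add lspan_smult)
      moreover have "Y + X $$ (i,j) \<cdot>\<^sub>m E_pair i j = X"
        unfolding Y_def using X by (simp add: mring)
      ultimately show ?thesis by simp
    qed
  qed
qed

text \<open>By linearity X may be taken to be an \<open>E_pair\<close>; its compression by
  \<open>A\<close> is then the wedge of two columns of \<open>A\<close>, which are fixed by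
  \<open>A\<close>, so \<open>wedge_in_span\<close> applies. This produces the diagonal blocks of an
  alternating matrix from brackets of even elements.\<close>

lemma sandwich_in_span:
  assumes A: "A \<in> Sym" "A * A = A" and X: "X \<in> Alt"
  shows "A * X * A \<in> lspan N {comm Y Z |Y Z. Y \<in> Ev A \<and> Z \<in> Ev A}" (is "_ \<in> ?L")
proof -
  have AM: "A \<in> M" using A by (auto dest: SymD)
  have "is_subspace N {X \<in> M. A * X * A \<in> ?L}"
    using subspaceD[OF subspace_lspan] AM
    by (auto simp: is_subspace_def mdistrib_left mdistrib_right msmult_left msmult_right)
  moreover have "E_pair i j \<in> {X \<in> M. A * X * A \<in> ?L}" if "i < N" "j < N" for i j
  proof -
    let ?a = "\<lambda>i. A *\<^sub>v unit_vec N i"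
    have a: "?a i \<in> carrier_vec N" for i using AM by simp
    have Aa: "A *\<^sub>v ?a i = ?a i" for i
      using AM A(2) assoc_mult_mat_vec[OF AM AM, of "unit_vec N i"] by simp
    have "A * E_pair i j * A = outer (?a i) (?a j) + outer (?a j) (?a i)"
      using AM SymD(2)[OF A(1)]
      by (simp add: E_pair_def mdistrib_left mdistrib_right mult_outer outer_mult_mat)
    also have "\<dots> \<in> ?L" by (rule wedge_in_span[OF A a Aa a Aa])
    finally show ?thesis by simp
  qed
  ultimately have "lspan N {E_pair i j |i j. i < N \<and> j < N} \<subseteq> {X \<in> M. A * X * A \<in> ?L}"
    by (intro lspan_least) auto
  then show ?thesis using Alt_subset_span X by blast
qed

lemma one_Sym: "1\<^sub>m N \<in> Sym" by (simp add: Sym_def)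

lemma Ev_one: "Ev (1\<^sub>m N) = Sym" by (auto simp: Ev_def mone dest: SymD)

text \<open>For the idempotent \<open>1\<^sub>m N\<close> every symmetric matrix is even and the
  compression is the matrix itself, so \<open>sandwich_in_span\<close> gives the harder
  inclusion.\<close>

lemma orth1_eq_Alt: "orth1 N = Alt"
proof
  show "orth1 N \<subseteq> Alt" unfolding orth1_def orth_eq_Sym
    by (rule lspan_least[OF subspace_Alt]) (auto intro: comm_Sym_Alt)
  show "Alt \<subseteq> orth1 N"
  proof
    fix X assume "X \<in> Alt"
    from sandwich_in_span[OF one_Sym _ this] AltD(2)[OF this] show "X \<in> orth1 N"
      by (simp add: mone Ev_one orth1_def orth_eq_Sym)
  qed
qed

text \<open>An off-diagonal entry is isolated by comparing both products with
  \<open>E_pair i j\<close> for a third index \<open>j\<close>, hence N \<ge> 3. For N = 2 the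
  alternating matrices form a line, whose nonzero elements commute with it without being
  scalar.\<close>

lemma centralizer_Alt:
  assumes "N \<ge> 3" and X: "X \<in> M" and comm: "\<And>Y. Y \<in> Alt \<Longrightarrow> X * Y = Y * X"
  obtains c where "X = c \<cdot>\<^sub>m 1\<^sub>m N"
proof -
  have idx1: "(X * E_pair i j) $$ (k,l) = X $$ (k,i) * (if l = j then 1 else 0) + X $$ (k,j) * (if l = i then 1 else 0)"
    if "i < N" "j < N" "k < N" "l < N" for i j k l
    using that X by (auto simp: E_pair_def mdistrib_left mult_outer) (auto simp: outer_def)
  have idx2: "(E_pair i j * X) $$ (k,l) = X $$ (j,l) * (if k = i then 1 else 0) + X $$ (i,l) * (if k = j then 1 else 0)"
    if "i < N" "j < N" "k < N" "l < N" for i j k l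
    using that X by (auto simp: E_pair_def mdistrib_right outer_mult_mat) (auto simp: outer_def)
  have eq: "(X * E_pair i j) $$ (k,l) = (E_pair i j * X) $$ (k,l)" for i j k l
    using comm[OF E_pair_Alt] by simp
  have off: "X $$ (k,i) = 0" if "k < N" "i < N" "k \<noteq> i" for k i
  proof -
    have "\<not> {..<N} \<subseteq> {k,i}" using card_mono[of "{k,i}" "{..<N}"] assms(1) that(3) by auto
    then obtain j where j: "j < N" "j \<noteq> k" "j \<noteq> i" by auto
    then show ?thesis using eq[of i j k j] that by (simp add: idx1 idx2)
  qed
  have diag: "X $$ (i,i) = X $$ (0,0)" if "i < N" for i
    using eq[of i 0 i 0] that assms(1) by (cases "i = 0") (simp_all add: idx1 idx2)
  define c where "c = X $$ (0,0)"
  have "X = c \<cdot>\<^sub>m 1\<^sub>m N"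
    using X off diag[folded c_def] by (intro eq_matI) auto
  then show thesis by (rule that)
qed

section \<open>The trace\<close>

definition tr :: "'a mat \<Rightarrow> 'a" where "tr X = (\<Sum>i<N. X $$ (i,i))"

lemma tr_mult_comm: assumes "X \<in> M" "Y \<in> M" shows "tr (X * Y) = tr (Y * X)"
proof -
  have "tr (X * Y) = (\<Sum>i<N. \<Sum>j<N. X $$ (i,j) * Y $$ (j,i))"
    using assms by (simp add: tr_def scalar_prod_def atLeast0LessThan)
  also have "\<dots> = (\<Sum>j<N. \<Sum>i<N. Y $$ (j,i) * X $$ (i,j))"
    by (subst sum.swap) (simp add: mult.commute)
  also have "\<dots> = tr (Y * X)"
    using assms by (simp add: tr_def scalar_prod_def atLeast0LessThan)
  finally show ?thesis .
qed

lemma tr_add: "X \<in> M \<Longrightarrow> Y \<in> M \<Longrightarrow> tr (X + Y) = tr X + tr Y"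
  by (simp add: tr_def sum.distrib)

lemma tr_smult: "X \<in> M \<Longrightarrow> tr (c \<cdot>\<^sub>m X) = c * tr X"
  by (simp add: tr_def sum_distrib_left)

lemma tr_comm: "X \<in> M \<Longrightarrow> Y \<in> M \<Longrightarrow> tr (comm X Y) = 0"
  by (simp add: comm_eq tr_add tr_mult_comm[of X Y])

lemma tr_one: "odd N \<Longrightarrow> tr (1\<^sub>m N) = 1"
proof -
  assume "odd N"
  then obtain k where k: "N = 2 * k + 1" by (rule oddE)
  have "tr (1\<^sub>m N) = of_nat N" by (simp add: tr_def)
  also have "\<dots> = of_nat k + of_nat k + 1" unfolding k by (simp only: mult_2 of_nat_add of_nat_1)
  finally show ?thesis by simp
qed

subsection \<open>The derived superalgebra of a symmetric idempotent\<close>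

text \<open>The even part of the derived superalgebra. The odd part gets no name of its own:
  \<open>A\<close> is even and acts as the identity on \<open>Od A\<close>, so bracketing even with
  odd elements gives back all of \<open>Od A\<close>.\<close>

definition Ev1 :: "'a mat \<Rightarrow> 'a mat set" where
  "Ev1 A = lspan N ({comm X Y |X Y. X \<in> Ev A \<and> Y \<in> Ev A} \<union> {comm X Y |X Y. X \<in> Od A \<and> Y \<in> Od A}
     \<union> {X * X |X. X \<in> Od A})"

lemma Ev_comm: assumes "A \<in> M" "X \<in> Ev A" "Y \<in> Ev A" shows "comm X Y \<in> Ev A"
proof -
  note X = EvD[OF assms(2)] and Y = EvD[OF assms(3)]
  have "A * (X * Y) = X * Y * A" "A * (Y * X) = Y * X * A"
    using X Y assms(1) by (metis mmult_assoc)+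
  then show ?thesis
    using AltD(1)[OF comm_Sym_Alt[OF X(1) Y(1)]] X(2) Y(2) assms(1)
    by (simp add: Ev_def comm_eq mdistrib_left mdistrib_right)
qed

text \<open>Shows that squares of odd elements have trace zero. The factor \<open>A * X\<close> need
  not be symmetric, so this is a commutator of matrices and not a bracket in the
  superalgebra.\<close>

lemma Od_sq_eq_comm: assumes "A \<in> M" "X \<in> Od A" shows "X * X = comm (A * X) X"
proof -
  note X = OdD[OF assms(2)]
  have "X * X = (A * X + X * A) * X" by (simp only: X(3))
  also have "\<dots> = comm (A * X) X" using X(2) assms(1) by (simp add: mring comm_eq)
  finally show ?thesis .
qed

lemma Od_mult:
  assumes "A \<in> M" "X \<in> Od A" shows "X * A = A * X + X"
proof -
  note X = OdD[OF assms(2)]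
  have "A * X + (A * X + X * A) = X * A" using X(2) assms(1) by (simp add: madd_left_self)
  then show ?thesis unfolding X(3) by simp
qed

text \<open>Moving \<open>A\<close> past an odd element turns it into 1 + \<open>A\<close>; moving
  it past two restores it.\<close>

lemma Od_sq: assumes A: "A \<in> M" "A * A = A" and X: "X \<in> Od A" shows "X * X \<in> Ev A"
proof -
  note X' = OdD[OF X] and XA = Od_mult[OF A(1) X]
  have "X * X * A = X * (A * X + X)" using A(1) X' XA by (simp add: mmult_assoc)
  also have "\<dots> = (X * A) * X + X * X" using A(1) X' by (simp add: mring)
  also have "\<dots> = A * (X * X)" unfolding XA using A(1) X' by (simp add: mring)
  finally show ?thesis using X' SymD(2)[OF X'(1)] by (simp add: Ev_def Sym_def mtransp)
qed

lemma comm_Od_polar: assumes "X \<in> M" "Y \<in> M" 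
  shows "comm X Y = (X + Y) * (X + Y) + (X * X + Y * Y)"
  using assms by (simp add: comm_eq mring)

text \<open>By polarisation this reduces to squares of odd elements.\<close>

lemma Od_comm: assumes A: "A \<in> M" "A * A = A" and X: "X \<in> Od A" and Y: "Y \<in> Od A"
  shows "comm X Y \<in> Ev A"
  using subspaceD(2)[OF subspace_Od[OF A(1)]] subspaceD(2)[OF subspace_Ev[OF A(1)]] Od_sq[OF A] X Y
  by (simp add: comm_Od_polar OdD(2))

text \<open>Bracketing with \<open>A\<close> is a derivation that kills X and fixes Y.\<close>

lemma Ev_Od_comm: assumes A: "A \<in> M" and X: "X \<in> Ev A" and Y: "Y \<in> Od A"
  shows "comm X Y \<in> Od A"
proof -
  note X = EvD[OF X] and Y = OdD[OF Y] Od_mult[OF A Y]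
  have "A * comm X Y + comm X Y * A = (A * X) * Y + A * (Y * X) + X * (Y * A) + Y * (X * A)"
    using A X(2) Y(2) by (simp add: comm_eq mring)
  also have "\<dots> = X * (A * Y) + A * (Y * X) + X * (Y * A) + Y * (A * X)"
    using A X Y(2) by (simp add: mmult_assoc)
  also have "\<dots> = X * (A * Y + Y * A) + (A * Y + Y * A) * X"
    using A X(2) Y(2) by (simp add: mring)
  also have "\<dots> = comm X Y" unfolding Y(3) by (simp add: comm_eq)
  finally show ?thesis using AltD(1)[OF comm_Sym_Alt[OF X(1) Y(1)]] by (simp add: Od_def)
qed

lemma Ev1_Ev: assumes "A \<in> M" "A * A = A" shows "Ev1 A \<subseteq> Ev A"
  unfolding Ev1_def using assms
  by (intro lspan_least subspace_Ev) (auto intro: Ev_comm Od_comm Od_sq)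

lemma Ev1_tr: assumes "A \<in> M" "X \<in> Ev1 A" shows "tr X = 0"
proof -
  have "Ev1 A \<subseteq> {X \<in> M. tr X = 0}"
    unfolding Ev1_def
  proof (intro lspan_least)
    show "is_subspace N {X \<in> M. tr X = 0}"
      by (auto simp: is_subspace_def tr_add tr_smult) (simp add: tr_def)
    show "{comm X Y |X Y. X \<in> Ev A \<and> Y \<in> Ev A} \<union> {comm X Y |X Y. X \<in> Od A \<and> Y \<in> Od A} \<union>
        {X * X |X. X \<in> Od A} \<subseteq> {X \<in> M. tr X = 0}"
      using assms(1) by (auto simp: tr_comm Od_sq_eq_comm EvD(2)[of _ A] OdD(2)[of _ A])
  qed
  then show ?thesis using assms(2) by auto
qed

lemma Od_tr: assumes "A \<in> Sym" "X \<in> Od A" shows "tr X = 0"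
  using Od_Alt[OF assms(1)] assms(2) by (auto simp: tr_def Alt_def)

lemma Ev1_gens:
  "X \<in> Ev A \<Longrightarrow> Y \<in> Ev A \<Longrightarrow> comm X Y \<in> Ev1 A"
  "X \<in> Od A \<Longrightarrow> Y \<in> Od A \<Longrightarrow> comm X Y \<in> Ev1 A"
  "X \<in> Od A \<Longrightarrow> X * X \<in> Ev1 A"
  unfolding Ev1_def by (rule lspan_gen; blast)+

lemma subspace_Ev1: "is_subspace N (Ev1 A)" unfolding Ev1_def by (rule subspace_lspan)

lemma compl_idem: assumes A: "A \<in> Sym" "A * A = A"
  shows "1\<^sub>m N + A \<in> Sym" "(1\<^sub>m N + A) * (1\<^sub>m N + A) = 1\<^sub>m N + A"
  using subspaceD(2)[OF subspace_Sym one_Sym A(1)] A SymD[OF A(1)] by (simp, simp add: mring)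

text \<open>Adding the identity does not change brackets with \<open>A\<close>. This is what later
  allows the two summands of the column space to be exchanged.\<close>

lemma Ev_Od_compl:
  assumes "A \<in> M" shows "Ev (1\<^sub>m N + A) = Ev A" "Od (1\<^sub>m N + A) = Od A"
proof -
  have "(1\<^sub>m N + A) * Y = Y * (1\<^sub>m N + A) \<longleftrightarrow> A * Y = Y * A" if "Y \<in> M" for Y
    using assms that by (simp add: mdistrib_left mdistrib_right mone) (metis madd_left_self mult_closed)
  then show "Ev (1\<^sub>m N + A) = Ev A" by (auto simp: Ev_def dest: SymD(1))
  have "(1\<^sub>m N + A) * Y + Y * (1\<^sub>m N + A) = A * Y + Y * A" if "Y \<in> M" for Y
    using assms that by (simp add: mring)
  then show "Od (1\<^sub>m N + A) = Od A" by (auto simp: Od_def dest: SymD(1))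
qed

text \<open>The compressions of X by the complementary idempotents \<open>A\<close> and 1 +
  \<open>A\<close> add up to X + AX + XA, which is X for even X. Both are spanned by brackets of
  even elements, since the two idempotents have the same even part.\<close>

lemma Alt_Ev_Ev1:
  assumes A: "A \<in> Sym" "A * A = A" and X: "X \<in> Alt" "X \<in> Ev A"
  shows "X \<in> Ev1 A"
proof -
  let ?B = "1\<^sub>m N + A"
  have AM: "A \<in> M" and XM: "X \<in> M" using A X by (auto dest: SymD AltD)
  note B = compl_idem[OF A]
  have "Ev ?B = Ev A" by (rule Ev_Od_compl(1)[OF AM])
  then have "A * X * A \<in> Ev1 A" "?B * X * ?B \<in> Ev1 A"
    using sandwich_in_span[OF A X(1)] sandwich_in_span[OF B X(1)] 
      lspan_least[OF subspace_Ev1, of "{comm Y Z |Y Z. Y \<in> Ev A \<and> Z \<in> Ev A}" A] Ev1_gens(1)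
    by auto
  then have "A * X * A + ?B * X * ?B \<in> Ev1 A" using subspaceD(2)[OF subspace_Ev1] by blast
  moreover have "A * X * A + ?B * X * ?B = X + (A * X + X * A)"
    using AM XM by (simp add: mring)
  moreover have "\<dots> = X" using EvD(3)[OF X(2)] XM AM by (simp add: mring)
  ultimately show ?thesis by simp
qed

section \<open>The adjoint action on alternating matrices\<close>

abbreviation adj :: "'a mat \<Rightarrow> 'a mat \<Rightarrow> 'a mat" where "adj \<equiv> ad_on N Alt"

lemma zero_Alt: "0\<^sub>m N N \<in> Alt" by (rule subspaceD(1)[OF subspace_Alt])

lemma ad_add: "X \<in> M \<Longrightarrow> Y \<in> M \<Longrightarrow> adj (X + Y) = (\<lambda>y. adj X y + adj Y y)"
  by (auto simp: ad_on_def comm_eq fun_eq_iff mring dest!: AltD(2))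

lemma ad_smult: "X \<in> M \<Longrightarrow> adj (c \<cdot>\<^sub>m X) = (\<lambda>y. c \<cdot>\<^sub>m adj X y)"
  by (auto simp: ad_on_def comm_eq fun_eq_iff mring dest!: AltD(2))

lemma ad_zero: "adj (0\<^sub>m N N) = (\<lambda>y. 0\<^sub>m N N)"
  by (auto simp: ad_on_def comm_eq fun_eq_iff mring dest!: AltD(2))

text \<open>Outside \<open>Alt\<close> the operator \<open>ad_on\<close> returns zero, which lies in
  \<open>Alt\<close>; in a composition the outer operator is therefore applied to this default
  value.\<close>

lemma comm_zero: "X \<in> M \<Longrightarrow> comm X (0\<^sub>m N N) = 0\<^sub>m N N"
  by (simp add: comm_eq)

lemma ad_closed: "X \<in> Sym \<Longrightarrow> Y \<in> Alt \<Longrightarrow> comm X Y \<in> Alt"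
  by (rule comm_Sym_Alt) (auto dest: AltD)

lemma ad_comm: assumes "X \<in> Sym" "Y \<in> Sym" shows "dcomm (adj X) (adj Y) = adj (comm X Y)"
proof
  fix z
  show "dcomm (adj X) (adj Y) z = adj (comm X Y) z"
    using assms ad_closed[OF assms(1)] ad_closed[OF assms(2)] SymD(1)[OF assms(1)] SymD(1)[OF assms(2)]
    by (auto simp: dcomm_def ad_on_def zero_Alt comm_zero dest!: AltD(2))
      (simp_all add: comm_eq minus_mat_eq_add mring)
qed

text \<open>The two mixed terms X z X cancel. The matrix \<open>X * X\<close> is symmetric but
  possibly not alternating, so the square can fall outside ad g.\<close>

lemma ad_sq: assumes "X \<in> Sym" shows "adj X \<circ> adj X = adj (X * X)"
proof
  fix z
  show "(adj X \<circ> adj X) z = adj (X * X) z"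
    using ad_closed[OF assms(1)] SymD(1)[OF assms(1)]
    by (auto simp: ad_on_def zero_Alt comm_zero dest!: AltD(2))
      (simp_all add: comm_eq minus_mat_eq_add mring)
qed

lemma ad_zero_imp:
  assumes N: "N \<ge> 3" "odd N" and X: "X \<in> M" "tr X = 0" and z: "\<And>Y. Y \<in> Alt \<Longrightarrow> comm X Y = 0\<^sub>m N N"
  shows "X = 0\<^sub>m N N"
proof -
  have "X * Y = Y * X" if "Y \<in> Alt" for Y
    using z[OF that] X AltD(2)[OF that] by (simp add: comm_eq madd_eq_zero_iff)
  then obtain c where c: "X = c \<cdot>\<^sub>m 1\<^sub>m N" using centralizer_Alt[OF N(1) X(1)] by blast
  then have "c = 0" using X(2) N(2) by (simp add: tr_smult tr_one)
  then show ?thesis unfolding c by (intro eq_matI) auto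
qed

lemma ad_inj:
  assumes N: "N \<ge> 3" "odd N" and X: "X \<in> M" "tr X = 0" and Y: "Y \<in> M" "tr Y = 0"
    and eq: "adj X = adj Y"
  shows "X = Y"
proof -
  have "comm (X + Y) Z = 0\<^sub>m N N" if "Z \<in> Alt" for Z
    using fun_cong[OF eq, of Z] fun_cong[OF ad_add[OF X(1) Y(1)], of Z] that X Y AltD(2)[OF that]
    by (simp add: ad_on_def madd_self)
  then have "X + Y = 0\<^sub>m N N" using ad_zero_imp[OF N, of "X + Y"] X Y by (simp add: tr_add)
  then show ?thesis using X Y by (simp add: madd_eq_zero_iff)
qed

subsection \<open>Identification with the superalgebra of the grading\<close>

text \<open>The common source of the two isomorphisms, to S(g^<1>) by \<open>adj\<close> and to the
  supermatrices by a change of basis.\<close>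

definition model_lsa :: "'a mat \<Rightarrow> ('a, 'a mat) lsa" where
  "model_lsa A = \<lparr>ev = Ev1 A, od = Od A, add = (+), smul = (\<cdot>\<^sub>m), br = comm, sq = (\<lambda>X. X * X)\<rparr>"

lemma comm_sym: "X \<in> M \<Longrightarrow> Y \<in> M \<Longrightarrow> comm X Y = comm Y X"
  by (simp add: comm_eq mring)

text \<open>Since \<open>A\<close> is idempotent, so is bracketing with it. The odd component of X
  is \<open>comm A X\<close>, and the even one is X + \<open>comm A X\<close>.\<close>

lemma Alt_decomp:
  assumes A: "A \<in> Sym" "A * A = A" and X: "X \<in> Alt"
  obtains U V where "U \<in> Alt \<inter> Ev A" "V \<in> Od A" "X = U + V"
proof
  have AM: "A \<in> M" and XM: "X \<in> M" using A X by (auto dest: SymD AltD)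
  have c: "comm A X \<in> Alt" using ad_closed[OF A(1) X] .
  have AA: "A * (A * Y) = A * Y" if "Y \<in> M" for Y
    using assoc_mult_mat[OF AM AM that] A(2) by simp
  have "A * comm A X + comm A X * A = comm A X"
    using AM XM by (simp add: comm_eq mring A(2) AA)
  then show "comm A X \<in> Od A" using c by (simp add: Od_def AltD)
  have "X + comm A X \<in> Alt" using subspaceD(2)[OF subspace_Alt X c] .
  moreover have "A * (X + comm A X) = (X + comm A X) * A"
    using AM XM by (simp add: comm_eq mring A(2) AA)
  ultimately show "X + comm A X \<in> Alt \<inter> Ev A" by (simp add: Ev_def AltD)
  show "X = X + comm A X + comm A X" using AM XM by (simp add: comm_eq mring)
qed

lemma Ev_Od_zero: assumes "A \<in> M" "X \<in> Ev A" "X \<in> Od A" shows "X = 0\<^sub>m N N"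
  using EvD(3)[OF assms(2)] OdD(2,3)[OF assms(3)] assms(1) by (simp add: madd_self)

lemma adj_eq: "Z \<in> Alt \<Longrightarrow> adj X Z = comm X Z" by (simp add: ad_on_def)

text \<open>The superalgebra \<open>model_lsa A\<close> with parity forgotten; its image under
  \<open>adj\<close> is g^<1>.\<close>

definition Tot :: "'a mat \<Rightarrow> 'a mat set" where "Tot A = {X + Y |X Y. X \<in> Ev1 A \<and> Y \<in> Od A}"

context
  fixes A :: "'a mat"
  assumes A: "A \<in> Sym" "A * A = A"
begin

lemma A_M: "A \<in> M" using A by (auto dest: SymD)

lemma Ev1_M: "X \<in> Ev1 A \<Longrightarrow> X \<in> M" "X \<in> Ev1 A \<Longrightarrow> X \<in> Sym" "X \<in> Ev1 A \<Longrightarrow> X \<in> Ev A"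
  using Ev1_Ev[OF A_M A(2)] by (auto dest: EvD)

lemma Tot_Sym: "Tot A \<subseteq> Sym"
  using Ev1_M subspaceD(2)[OF subspace_Sym] by (auto simp: Tot_def dest: OdD)

lemma subspace_Tot: "is_subspace N (Tot A)"
  unfolding is_subspace_def
proof (intro conjI ballI allI)
  note s0 = subspaceD[OF subspace_Ev1[of A]] and s1 = subspaceD[OF subspace_Od[OF A_M]]
  have "0\<^sub>m N N = 0\<^sub>m N N + (0\<^sub>m N N :: 'a mat)" by simp
  then show "0\<^sub>m N N \<in> Tot A" using s0(1) s1(1) unfolding Tot_def by blast
  fix x y c assume "x \<in> Tot A"
  then obtain X Y where x: "x = X + Y" "X \<in> Ev1 A" "Y \<in> Od A" by (auto simp: Tot_def)
  then have "c \<cdot>\<^sub>m x = c \<cdot>\<^sub>m X + c \<cdot>\<^sub>m Y" using Ev1_M OdD(2)[OF x(3)] by (simp add: msmult_add)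
  then show "c \<cdot>\<^sub>m x \<in> Tot A" using s0(3) s1(3) x unfolding Tot_def by blast
  assume "y \<in> Tot A"
  then obtain X' Y' where y: "y = X' + Y'" "X' \<in> Ev1 A" "Y' \<in> Od A" by (auto simp: Tot_def)
  have "x + y = (X + X') + (Y + Y')"
    using x y Ev1_M OdD(2)[OF x(3)] OdD(2)[OF y(3)] by (simp add: mring)
  then show "x + y \<in> Tot A" using s0(2) s1(2) x y unfolding Tot_def by blast
qed

lemma Tot_comm: assumes "x \<in> Tot A" "y \<in> Tot A" shows "comm x y \<in> Tot A"
proof -
  note s0 = subspaceD[OF subspace_Ev1[of A]] and s1 = subspaceD[OF subspace_Od[OF A_M]]
  obtain X Y where x: "x = X + Y" "X \<in> Ev1 A" "Y \<in> Od A" using assms by (auto simp: Tot_def)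
  obtain X' Y' where y: "y = X' + Y'" "X' \<in> Ev1 A" "Y' \<in> Od A" using assms by (auto simp: Tot_def)
  have "comm x y = (comm X X' + comm Y Y') + (comm X Y' + comm X' Y)"
    using x y Ev1_M OdD(2)[OF x(3)] OdD(2)[OF y(3)] by (simp add: mring comm_eq)
  moreover have "comm X X' + comm Y Y' \<in> Ev1 A"
    using x y Ev1_M by (intro s0(2) Ev1_gens)
  moreover have "comm X Y' + comm X' Y \<in> Od A"
    using x y Ev1_M A_M by (intro s1(2) Ev_Od_comm)
  ultimately show ?thesis unfolding Tot_def by blast
qed

lemma Ev1_sub_Tot: "Ev1 A \<subseteq> Tot A"
proof
  fix X assume X: "X \<in> Ev1 A"
  then have "X = X + 0\<^sub>m N N" using Ev1_M by simp
  then show "X \<in> Tot A" using X subspaceD(1)[OF subspace_Od[OF A_M]] unfolding Tot_def by blast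
qed

lemma Od_sub_Tot: "Od A \<subseteq> Tot A"
proof
  fix X assume X: "X \<in> Od A"
  then have "X = 0\<^sub>m N N + X" using OdD by simp
  then show "X \<in> Tot A" using X subspaceD(1)[OF subspace_Ev1] unfolding Tot_def by blast
qed

lemma Alt_sub_Tot: "Alt \<subseteq> Tot A"
proof
  fix X assume "X \<in> Alt"
  then obtain U V where "U \<in> Alt \<inter> Ev A" "V \<in> Od A" "X = U + V" by (rule Alt_decomp[OF A])
  then show "X \<in> Tot A" using Alt_Ev_Ev1[OF A] unfolding Tot_def by blast
qed

text \<open>\<open>Tot A\<close> contains \<open>Alt\<close> and the squares of odd elements and is
  closed under brackets, which bounds g^<1> from above. Conversely, the brackets generating
  \<open>Ev1 A\<close> are alternating, so they act by elements of ad g, and the generating squares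
  act by exactly the adjoined operators.\<close>

lemma g_one_eq: "g_one N Alt (Od A) = adj ` Tot A"
proof
  note s = subspaceD[OF subspace_Tot] and TM = Tot_Sym[THEN subsetD] 
  note TM' = TM[THEN SymD(1)]
  show "g_one N Alt (Od A) \<subseteq> adj ` Tot A"
  proof
    fix D assume "D \<in> g_one N Alt (Od A)"
    then show "D \<in> adj ` Tot A"
    proof induction
      case (g_one_ad x) then show ?case using Alt_sub_Tot by blast
    next
      case (g_one_sq x)
      then show ?case using ad_sq[OF OdD(1)] Ev1_gens(3) Ev1_sub_Tot by blast
    next
      case g_one_zero then show ?case using ad_zero s(1) by force
    next
      case (g_one_add D E) then show ?case using ad_add[OF TM' TM', symmetric] s(2) by auto
    next
      case (g_one_smult D c) then show ?case using ad_smult[OF TM', symmetric] s(3) by auto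
    next
      case (g_one_br D E) then show ?case using ad_comm[OF TM TM] Tot_comm by auto
    qed
  qed
  have Od: "adj Y \<in> g_one N Alt (Od A)" if "Y \<in> Od A" for Y
    using that Od_Alt[OF A(1)] by (auto intro: g_one_ad)
  have "Ev1 A \<subseteq> {X \<in> M. adj X \<in> g_one N Alt (Od A)}"
    unfolding Ev1_def
  proof (intro lspan_least Un_least subsetI)
    show "is_subspace N {X \<in> M. adj X \<in> g_one N Alt (Od A)}"
      by (auto simp: is_subspace_def ad_add ad_smult ad_zero intro: g_one_zero g_one_add g_one_smult)
    fix x assume "x \<in> {comm X Y |X Y. X \<in> Ev A \<and> Y \<in> Ev A}"
    then have "x \<in> Alt" by (auto intro: comm_Sym_Alt dest: EvD)
    then show "x \<in> {X \<in> M. adj X \<in> g_one N Alt (Od A)}" by (auto intro: g_one_ad dest: AltD)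
  next
    fix x assume "x \<in> {comm X Y |X Y. X \<in> Od A \<and> Y \<in> Od A}"
    then have "x \<in> Alt" by (auto intro: comm_Sym_Alt dest: OdD)
    then show "x \<in> {X \<in> M. adj X \<in> g_one N Alt (Od A)}" by (auto intro: g_one_ad dest: AltD)
  next
    fix x assume "x \<in> {X * X |X. X \<in> Od A}"
    then obtain X where "x = X * X" "X \<in> Od A" by blast
    then show "x \<in> {X \<in> M. adj X \<in> g_one N Alt (Od A)}"
      using g_one_sq[of X "Od A" N Alt] OdD[of X A] by (simp add: ad_sq)
  qed
  then have "adj (X + Y) \<in> g_one N Alt (Od A)" if "X \<in> Ev1 A" "Y \<in> Od A" for X Y
    unfolding ad_add[OF Ev1_M(1)[OF that(1)] OdD(2)[OF that(2)]]
    using that Od by (intro g_one_add) auto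
  then show "adj ` Tot A \<subseteq> g_one N Alt (Od A)" by (auto simp: Tot_def)
qed

lemma adj_Tot: "X \<in> Ev1 A \<Longrightarrow> Y \<in> Od A \<Longrightarrow> Z \<in> Alt \<Longrightarrow> adj (X + Y) Z = comm X Z + comm Y Z"
  using Ev1_M(1) by (simp add: ad_add OdD(2) adj_eq)

text \<open>Write an even operator as the action of X + Y with X even and Y odd. The action of Y is
  then a sum of two even operators but reverses parity, so it vanishes on both graded pieces. Hence
  Y centralises \<open>Alt\<close>, and its trace forces Y = 0.\<close>

lemma even_part:
  assumes N: "N \<ge> 3" "odd N"
  shows "{D \<in> g_one N Alt (Od A). D ` (Alt \<inter> Ev A) \<subseteq> Alt \<inter> Ev A \<and> D ` Od A \<subseteq> Od A} = adj ` Ev1 A"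
    (is "?L = _")
proof
  have OdAlt: "Z \<in> Alt" if "Z \<in> Od A" for Z using that Od_Alt[OF A(1)] by blast
  note s0 = subspaceD[OF subspace_Ev[OF A_M]] and s1 = subspaceD[OF subspace_Od[OF A_M]]
  show "adj ` Ev1 A \<subseteq> ?L"
    unfolding g_one_eq using Ev1_sub_Tot
    by (auto simp: adj_eq OdAlt intro: ad_closed[OF Ev1_M(2)] Ev_comm[OF A_M Ev1_M(3)] Ev_Od_comm[OF A_M Ev1_M(3)])
  show "?L \<subseteq> adj ` Ev1 A"
  proof
    fix D assume D: "D \<in> ?L"
    then obtain X Y where XY: "D = adj (X + Y)" "X \<in> Ev1 A" "Y \<in> Od A"
      by (auto simp: g_one_eq Tot_def)
    have YM: "Y \<in> M" and XM: "X \<in> M" and XE: "X \<in> Ev A" using XY Ev1_M by (auto dest: OdD)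
    have *: "comm Y Z = D Z + comm X Z" if "Z \<in> Alt" for Z
      using that XM YM AltD(2)[OF that] by (simp add: XY(1) adj_Tot[OF XY(2,3)] mring)
    have z0: "comm Y Z = 0\<^sub>m N N" if "Z \<in> Alt \<inter> Ev A" for Z
    proof (rule Ev_Od_zero[OF A_M])
      have "D Z \<in> Ev A" using D that by blast
      then show "comm Y Z \<in> Ev A" using that A_M XE by (auto simp: * intro!: s0(2) Ev_comm)
      show "comm Y Z \<in> Od A" using Ev_Od_comm[OF A_M _ XY(3), of Z] that YM comm_sym[of Y Z] EvD(2)[of Z A] by auto
    qed
    have z1: "comm Y Z = 0\<^sub>m N N" if "Z \<in> Od A" for Z
    proof (rule Ev_Od_zero[OF A_M])
      have "D Z \<in> Od A" using D that by blast
      then show "comm Y Z \<in> Od A" using that A_M XE OdAlt by (auto simp: * intro!: s1(2) Ev_Od_comm)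
      show "comm Y Z \<in> Ev A" by (rule Od_comm[OF A_M A(2) XY(3) that])
    qed
    have "Y = 0\<^sub>m N N"
    proof (rule ad_zero_imp[OF N YM Od_tr[OF A(1) XY(3)]])
      fix Z assume "Z \<in> Alt"
      then obtain U V where U: "U \<in> Alt \<inter> Ev A" "V \<in> Od A" "Z = U + V" by (rule Alt_decomp[OF A])
      then have "comm Y Z = comm Y U + comm Y V"
        using YM EvD(2)[of U A] OdD(2)[of V A] by (simp add: comm_eq mring)
      then show "comm Y Z = 0\<^sub>m N N" using z0[OF U(1)] z1[OF U(2)] by simp
    qed
    then show "D \<in> adj ` Ev1 A" using XY XM by simp
  qed
qed

text \<open>The argument for even operators with the parities exchanged. Now X must vanish, and only
  the trace excludes that X is a nonzero scalar, since scalars are even.\<close>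

lemma odd_part:
  assumes N: "N \<ge> 3" "odd N"
  shows "{D \<in> g_one N Alt (Od A). D ` (Alt \<inter> Ev A) \<subseteq> Od A \<and> D ` Od A \<subseteq> Alt \<inter> Ev A} = adj ` Od A"
    (is "?L = _")
proof
  have OdAlt: "Z \<in> Alt" if "Z \<in> Od A" for Z using that Od_Alt[OF A(1)] by blast
  note s0 = subspaceD[OF subspace_Ev[OF A_M]] and s1 = subspaceD[OF subspace_Od[OF A_M]]
  have EO: "comm Y Z \<in> Od A" if "Y \<in> Od A" "Z \<in> Ev A" for Y Z
    using Ev_Od_comm[OF A_M that(2,1)] comm_sym[of Y Z] EvD(2)[OF that(2)] OdD(2)[OF that(1)] by simp
  show "adj ` Od A \<subseteq> ?L"
    unfolding g_one_eq using Od_sub_Tot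
    by (auto simp: adj_eq OdAlt intro: ad_closed[OF OdD(1)[of _ A]] ad_closed[OF OdD(1)[of _ A] OdAlt] Od_comm[OF A_M A(2)] EO)
  show "?L \<subseteq> adj ` Od A"
  proof
    fix D assume D: "D \<in> ?L"
    then obtain X Y where XY: "D = adj (X + Y)" "X \<in> Ev1 A" "Y \<in> Od A"
      by (auto simp: g_one_eq Tot_def)
    have YM: "Y \<in> M" and XM: "X \<in> M" and XE: "X \<in> Ev A" using XY Ev1_M by (auto dest: OdD)
    have *: "comm X Z = D Z + comm Y Z" if "Z \<in> Alt" for Z
      using that XM YM AltD(2)[OF that] by (simp add: XY(1) adj_Tot[OF XY(2,3)] mring)
    have z0: "comm X Z = 0\<^sub>m N N" if "Z \<in> Alt \<inter> Ev A" for Z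
    proof (rule Ev_Od_zero[OF A_M])
      have "D Z \<in> Od A" using D that by blast
      then show "comm X Z \<in> Od A" using that XY(3) by (auto simp: * intro!: s1(2) EO)
      show "comm X Z \<in> Ev A" using that XE A_M by (auto intro: Ev_comm)
    qed
    have z1: "comm X Z = 0\<^sub>m N N" if "Z \<in> Od A" for Z
    proof (rule Ev_Od_zero[OF A_M])
      have "D Z \<in> Ev A" using D that by blast
      then show "comm X Z \<in> Ev A" using that A_M A(2) XY(3) OdAlt by (auto simp: * intro!: s0(2) Od_comm)
      show "comm X Z \<in> Od A" by (rule Ev_Od_comm[OF A_M XE that])
    qed
    have "X = 0\<^sub>m N N"
    proof (rule ad_zero_imp[OF N XM Ev1_tr[OF A_M XY(2)]])
      fix Z assume "Z \<in> Alt"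
      then obtain U V where U: "U \<in> Alt \<inter> Ev A" "V \<in> Od A" "Z = U + V" by (rule Alt_decomp[OF A])
      then have "comm X Z = comm X U + comm X V"
        using XM EvD(2)[of U A] OdD(2)[of V A] by (simp add: comm_eq mring)
      then show "comm X Z = 0\<^sub>m N N" using z0[OF U(1)] z1[OF U(2)] by simp
    qed
    then show "D \<in> adj ` Od A" using XY YM by simp
  qed
qed

lemma model_iso_S_g_one:
  assumes N: "N \<ge> 3" "odd N"
  shows "lsa_isomorphic (model_lsa A) (S_g_one N Alt (Alt \<inter> Ev A) (Od A))"
proof -
  have S: "S_g_one N Alt (Alt \<inter> Ev A) (Od A) = \<lparr>ev = adj ` Ev1 A, od = adj ` Od A,
      add = (\<lambda>D E y. D y + E y), smul = (\<lambda>c D y. c \<cdot>\<^sub>m D y), br = dcomm, sq = (\<lambda>D. D \<circ> D)\<rparr>"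
    unfolding S_g_one_def even_part[OF N] odd_part[OF N] ..
  have "inj_on adj (Ev1 A)" "inj_on adj (Od A)"
    using ad_inj[OF N] Ev1_M Ev1_tr[OF A_M] Od_tr[OF A(1)] OdD(2)[of _ A] by (auto intro!: inj_onI)
  then show ?thesis
    unfolding lsa_isomorphic_def S model_lsa_def lin_on_def
    using Ev1_M OdD[of _ A]
    by (intro exI[of _ adj]) (simp add: bij_betw_def ad_add ad_smult ad_comm ad_sq)
qed

lemma model_closed:
  "x \<in> ev (model_lsa A) \<Longrightarrow> y \<in> ev (model_lsa A) \<Longrightarrow> add (model_lsa A) x y \<in> ev (model_lsa A)"
  "x \<in> od (model_lsa A) \<Longrightarrow> y \<in> od (model_lsa A) \<Longrightarrow> add (model_lsa A) x y \<in> od (model_lsa A)"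
  "x \<in> ev (model_lsa A) \<Longrightarrow> smul (model_lsa A) c x \<in> ev (model_lsa A)"
  "x \<in> od (model_lsa A) \<Longrightarrow> smul (model_lsa A) c x \<in> od (model_lsa A)"
  "x \<in> ev (model_lsa A) \<Longrightarrow> y \<in> ev (model_lsa A) \<Longrightarrow> br (model_lsa A) x y \<in> ev (model_lsa A)"
  "x \<in> ev (model_lsa A) \<Longrightarrow> y \<in> od (model_lsa A) \<Longrightarrow> br (model_lsa A) x y \<in> od (model_lsa A)"
  "x \<in> od (model_lsa A) \<Longrightarrow> y \<in> od (model_lsa A) \<Longrightarrow> br (model_lsa A) x y \<in> ev (model_lsa A)"
  "x \<in> od (model_lsa A) \<Longrightarrow> sq (model_lsa A) x \<in> ev (model_lsa A)"
  using subspaceD[OF subspace_Ev1[of A]] subspaceD[OF subspace_Od[OF A_M]] Ev1_M Ev1_gens[of _ A]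
    Ev_Od_comm[OF A_M]
  by (simp_all add: model_lsa_def)

end

subsection \<open>Identification with the matrix superalgebra\<close>

text \<open>The columns of \<open>P\<close> form the adapted basis: \<open>A\<close> kills the first
  \<open>a\<close> of them and fixes the last \<open>b\<close>. \<open>G\<close> is their Gram
  matrix; the normal forms used are all their own inverses.\<close>

context
  fixes A P G :: "'a mat" and a b :: nat and B1 B2 :: "'a mat"
  assumes A: "A \<in> Sym" "A * A = A" and P: "P \<in> M" and ab: "N = a + b"
    and GP: "transpose_mat P * P = G" and GG: "G * G = 1\<^sub>m N" 
    and G: "G = diag_block B1 B2"
    and E: "A * P = P * mat_diag N (\<lambda>i. if a \<le> i then 1 else 0)"
begin

text \<open>The inverse of \<open>P\<close>, read off from P^T P = G and G^2 = 1; \<open>phi\<close>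
  is thus conjugation with the basis.\<close>

definition R :: "'a mat" where "R = G * transpose_mat P"
definition E where "E = mat_diag N (\<lambda>i. if a \<le> i then (1::'a) else 0)"
definition phi :: "'a mat \<Rightarrow> 'a mat" where "phi X = R * X * P"

lemma G_M: "G \<in> M" using GP P by auto
lemma G_sym: "transpose_mat G = G" using P unfolding GP[symmetric] by (simp add: mtransp)
lemma R_M: "R \<in> M" using G_M P by (simp add: R_def)
lemma E_M: "E \<in> M" by (simp add: E_def)
lemma AM: "A \<in> M" using A by (simp add: SymD)

lemma RP: "R * P = 1\<^sub>m N" using G_M P GP GG by (simp add: R_def mmult_assoc)

lemma PR: "P * R = 1\<^sub>m N" by (rule mat_mult_left_right_inverse[OF R_M P RP])

lemma RP': "X \<in> M \<Longrightarrow> R * (P * X) = X"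
  using assoc_mult_mat[OF R_M P, of X N] by (simp add: RP)

lemma PR': "X \<in> M \<Longrightarrow> P * (R * X) = X"
  using assoc_mult_mat[OF P R_M, of X N] by (simp add: PR)

lemma phi_M: "X \<in> M \<Longrightarrow> phi X \<in> M" using R_M P by (simp add: phi_def)

lemma phi_mult: "X \<in> M \<Longrightarrow> Y \<in> M \<Longrightarrow> phi X * phi Y = phi (X * Y)"
  using R_M P by (simp add: phi_def mmult_assoc PR')

lemma phi_add: "X \<in> M \<Longrightarrow> Y \<in> M \<Longrightarrow> phi (X + Y) = phi X + phi Y"
  using R_M P by (simp add: phi_def mdistrib_left mdistrib_right)

lemma phi_smult: "X \<in> M \<Longrightarrow> phi (c \<cdot>\<^sub>m X) = c \<cdot>\<^sub>m phi X"
  using R_M P by (simp add: phi_def msmult_left msmult_right)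

lemma phi_comm: "X \<in> M \<Longrightarrow> Y \<in> M \<Longrightarrow> phi (comm X Y) = comm (phi X) (phi Y)"
  by (simp add: comm_eq phi_add phi_mult)

lemma phi_zero: "phi (0\<^sub>m N N) = 0\<^sub>m N N"
  using R_M P by (simp add: phi_def)

lemma phi_inj: "inj_on phi M"
proof (rule inj_on_inverseI)
  fix X assume "X \<in> M"
  then show "P * phi X * R = X" using R_M P by (simp add: phi_def mmult_assoc PR' PR)
qed

lemma phi_E: "phi A = E"
  using R_M P AM E E_M by (simp add: phi_def mmult_assoc E_def[symmetric] RP')

lemma phi_lspan: assumes "S \<subseteq> M" shows "lspan N (phi ` S) = phi ` lspan N S"
proof
  have LM: "X \<in> M" if "X \<in> lspan N S" for X using lspan_carrier[OF assms that] .
  show "lspan N (phi ` S) \<subseteq> phi ` lspan N S"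
  proof (rule lspan_least)
    show "is_subspace N (phi ` lspan N S)"
      using phi_zero[symmetric] subspaceD[OF subspace_lspan[of S]]
      by (auto simp: is_subspace_def phi_add[symmetric] phi_smult[symmetric] LM)
  qed (auto intro: lspan_gen)
  show "phi ` lspan N S \<subseteq> lspan N (phi ` S)"
  proof clarify
    fix X assume "X \<in> lspan N S"
    then show "phi X \<in> lspan N (phi ` S)"
      by induction (auto simp: phi_zero phi_add phi_smult LM intro: lspan.intros)
  qed
qed

text \<open>For symmetric X the product \<open>G * phi X\<close> equals P^T X P, which is symmetric.
  In the other direction the condition on Y becomes G Y^T = Y G, and this makes P Y R
  symmetric.\<close>

lemma phi_Sym: "orth_G G N = phi ` Sym"
proof
  show "phi ` Sym \<subseteq> orth_G G N"
  proof clarify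
    fix X assume X: "X \<in> Sym"
    note X' = SymD[OF X]
    have GG': "G * (G * Y) = Y" if "Y \<in> M" for Y
      using assoc_mult_mat[OF G_M G_M that] GG that by simp
    have "G * phi X = transpose_mat P * X * P"
      using G_M P X' by (simp add: phi_def R_def mmult_assoc GG')
    moreover have "transpose_mat (phi X) * G = transpose_mat P * X * P"
      using G_M P X' R_M GG by (simp add: phi_def R_def mmult_assoc mtransp G_sym)
    moreover have "transpose_mat P * X * P \<in> M" using P X' by simp
    ultimately show "phi X \<in> orth_G G N"
      unfolding orth_G_def using phi_M[OF X'(1)] madd_self by simp
  qed
  show "orth_G G N \<subseteq> phi ` Sym"
  proof
    fix Y assume "Y \<in> orth_G G N"
    then have Y: "Y \<in> M" and "transpose_mat Y * G + G * Y = 0\<^sub>m N N" by (auto simp: orth_G_def)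
    then have eq: "transpose_mat Y * G = G * Y" using G_M by (simp add: madd_eq_zero_iff)
    have "G * transpose_mat Y = G * (transpose_mat Y * G) * G"
      using Y G_M GG by (simp add: mmult_assoc)
    also have "\<dots> = G * G * Y * G" unfolding eq using Y G_M by (simp add: mmult_assoc)
    also have "\<dots> = Y * G" using Y G_M GG by simp
    finally have eq': "G * transpose_mat Y = Y * G" .
    have "transpose_mat (P * Y * R) = P * (G * transpose_mat Y) * transpose_mat P"
      using P Y G_M R_M by (simp add: R_def mtransp G_sym mmult_assoc)
    also have "\<dots> = P * Y * R" unfolding eq' using P Y G_M by (simp add: R_def mmult_assoc)
    finally have "P * Y * R \<in> Sym" using P Y R_M by (simp add: Sym_def)
    moreover have "Y = phi (P * Y * R)" using P Y R_M by (simp add: phi_def mmult_assoc RP' RP)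
    ultimately show "Y \<in> phi ` Sym" by blast
  qed
qed

lemma E_left: "Y \<in> M \<Longrightarrow> i < N \<Longrightarrow> j < N \<Longrightarrow> (E * Y) $$ (i,j) = (if a \<le> i then Y $$ (i,j) else 0)"
  by (simp add: E_def mat_diag_mult_left)

lemma E_right: "Y \<in> M \<Longrightarrow> i < N \<Longrightarrow> j < N \<Longrightarrow> (Y * E) $$ (i,j) = (if a \<le> j then Y $$ (i,j) else 0)"
  by (simp add: E_def mat_diag_mult_right)

lemma mat_eq_iff_index: "X \<in> M \<Longrightarrow> Y \<in> M \<Longrightarrow> X = Y \<longleftrightarrow> (\<forall>i<N. \<forall>j<N. X $$ (i,j) = Y $$ (i,j))"
  by (auto intro: eq_matI)

text \<open>\<open>E\<close> projects onto the second block. An entry in a mixed block survives in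
  exactly one of \<open>E * Y\<close> and \<open>Y * E\<close>, an entry in a diagonal block in both
  or in neither.\<close>

lemma even_smat_iff: assumes Y: "Y \<in> M" shows "even_smat a b Y \<longleftrightarrow> E * Y = Y * E"
  unfolding mat_eq_iff_index[OF mult_closed[OF E_M Y] mult_closed[OF Y E_M]]
  using Y by (auto simp: even_smat_def ab[symmetric] E_left E_right not_less simp del: index_mult_mat split: if_splits)

lemma odd_smat_iff: assumes Y: "Y \<in> M" shows "odd_smat a b Y \<longleftrightarrow> E * Y + Y * E = Y"
proof -
  have "E * Y + Y * E \<in> M" using E_M Y by simp
  moreover have "(E * Y + Y * E) $$ (i,j) = (if a \<le> i then Y $$ (i,j) else 0) + (if a \<le> j then Y $$ (i,j) else 0)"
    if "i < N" "j < N" for i j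
    using that E_M Y E_left[OF Y that] E_right[OF Y that] by (simp del: index_mult_mat(1))
  ultimately show ?thesis
    unfolding odd_smat_def ab[symmetric]
    using Y by (auto simp: mat_eq_iff_index not_less split: if_splits)
qed

lemma phi_Ev: "oo_ev B1 B2 a b = phi ` Ev A"
proof -
  have "even_smat a b (phi X) \<longleftrightarrow> A * X = X * A" if "X \<in> Sym" for X
    using SymD(1)[OF that] AM inj_onD[OF phi_inj, of "A * X" "X * A"]
    by (auto simp: even_smat_iff phi_M phi_E[symmetric] phi_mult)
  then show ?thesis unfolding oo_ev_def G[symmetric] ab[symmetric] phi_Sym Ev_def by auto
qed

lemma phi_Od: "oo_od B1 B2 a b = phi ` Od A"
proof -
  have "odd_smat a b (phi X) \<longleftrightarrow> A * X + X * A = X" if "X \<in> Sym" for X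
    using SymD(1)[OF that] AM inj_onD[OF phi_inj, of "A * X + X * A" "X"]
    by (auto simp: odd_smat_iff phi_M phi_E[symmetric] phi_mult phi_add[symmetric])
  then show ?thesis unfolding oo_od_def G[symmetric] ab[symmetric] phi_Sym Od_def by auto
qed

lemma A_Ev: "A \<in> Ev A" using A by (simp add: Ev_def)

lemma lspan_comm_Ev_Od: "lspan N {comm X Y |X Y. X \<in> Ev A \<and> Y \<in> Od A} = Od A" (is "lspan N ?S = _")
proof
  show "lspan N ?S \<subseteq> Od A"
    by (rule lspan_least[OF subspace_Od[OF AM]]) (auto intro: Ev_Od_comm[OF AM])
  show "Od A \<subseteq> lspan N ?S"
  proof
    fix X assume X: "X \<in> Od A"
    then have "X = comm A X" using OdD(3)[OF X] by (simp add: comm_eq)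
    then show "X \<in> lspan N ?S" using A_Ev X by (intro lspan_gen) blast
  qed
qed

lemma oo1_eq: "oo1 B1 B2 a b = \<lparr>ev = phi ` Ev1 A, od = phi ` Od A, add = (+), smul = (\<cdot>\<^sub>m), br = comm, sq = (\<lambda>X. X * X)\<rparr>"
proof -
  have c: "{comm X Y |X Y. X \<in> phi ` U \<and> Y \<in> phi ` V} = phi ` {comm X Y |X Y. X \<in> U \<and> Y \<in> V}"
    if UV: "U \<subseteq> M" "V \<subseteq> M" for U V
  proof (intro equalityI subsetI)
    fix x assume "x \<in> {comm X Y |X Y. X \<in> phi ` U \<and> Y \<in> phi ` V}"
    then obtain X Y where "x = comm (phi X) (phi Y)" "X \<in> U" "Y \<in> V" by blast
    moreover from this have "x = phi (comm X Y)" using UV[THEN subsetD] phi_comm by simp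
    ultimately show "x \<in> phi ` {comm X Y |X Y. X \<in> U \<and> Y \<in> V}" by blast
  next
    fix x assume "x \<in> phi ` {comm X Y |X Y. X \<in> U \<and> Y \<in> V}"
    then obtain X Y where "x = phi (comm X Y)" "X \<in> U" "Y \<in> V" by blast
    moreover from this have "x = comm (phi X) (phi Y)" using UV[THEN subsetD] phi_comm by simp
    ultimately show "x \<in> {comm X Y |X Y. X \<in> phi ` U \<and> Y \<in> phi ` V}" by blast
  qed
  have s: "{X * X |X. X \<in> phi ` Od A} = phi ` {X * X |X. X \<in> Od A}"
  proof (intro equalityI subsetI)
    fix x assume "x \<in> {X * X |X. X \<in> phi ` Od A}"
    then obtain X where "x = phi X * phi X" "X \<in> Od A" by blast
    moreover from this have "x = phi (X * X)" using OdD(2)[of X A] phi_mult by auto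
    ultimately show "x \<in> phi ` {X * X |X. X \<in> Od A}" by blast
  next
    fix x assume "x \<in> phi ` {X * X |X. X \<in> Od A}"
    then obtain X where "x = phi (X * X)" "X \<in> Od A" by blast
    moreover from this have "x = phi X * phi X" using OdD(2)[of X A] phi_mult by auto
    ultimately show "x \<in> {X * X |X. X \<in> phi ` Od A}" by blast
  qed
  have EM: "Ev A \<subseteq> M" and OM: "Od A \<subseteq> M" using EvD(2) OdD(2) by blast+
  have gM: "{comm X Y |X Y. X \<in> Ev A \<and> Y \<in> Od A} \<subseteq> M"
    "({comm X Y |X Y. X \<in> Ev A \<and> Y \<in> Ev A} \<union> {comm X Y |X Y. X \<in> Od A \<and> Y \<in> Od A}
     \<union> {X * X |X. X \<in> Od A}) \<subseteq> M" using EM[THEN subsetD] OM[THEN subsetD] by (auto intro: mult_closed)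
  show ?thesis
    unfolding oo1_def Let_def phi_Ev phi_Od c[OF EM EM] c[OF OM OM] c[OF EM OM] s ab[symmetric]
      image_Un[symmetric] phi_lspan[OF gM(1)] phi_lspan[OF gM(2)] lspan_comm_Ev_Od Ev1_def ..
qed

lemma model_iso_oo1: "lsa_isomorphic (model_lsa A) (oo1 B1 B2 a b)"
proof -
  have "inj_on phi (Ev1 A)" "inj_on phi (Od A)"
    using Ev1_M(1)[OF A] OdD(2)[of _ A] by (auto intro: inj_on_subset[OF phi_inj])
  then show ?thesis
    unfolding lsa_isomorphic_def oo1_eq model_lsa_def lin_on_def
    using Ev1_M[OF A] OdD[of _ A]
    by (intro exI[of _ phi]) (simp add: bij_betw_def phi_add phi_smult phi_comm phi_mult)
qed

end

subsection \<open>Bases adapted to a symmetric idempotent\<close>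

text \<open>Linear independence is not demanded: an invertible Gram matrix \<open>B\<close> implies
  it.\<close>

definition frame :: "'a mat \<Rightarrow> nat \<Rightarrow> 'a mat \<Rightarrow> (nat \<Rightarrow> 'a vec) \<Rightarrow> bool" where
  "frame A m B v \<longleftrightarrow> (\<forall>i<m. v i \<in> carrier_vec N \<and> A *\<^sub>v v i = v i) \<and>
     (\<forall>i<m. \<forall>j<m. v i \<bullet> v j = B $$ (i,j))"

definition vmat :: "nat \<Rightarrow> (nat \<Rightarrow> 'a vec) \<Rightarrow> 'a mat" where
  "vmat m v = mat N m (\<lambda>(r,j). v j $ r)"

text \<open>For \<open>B * B = 1\<close> the second summand is the orthogonal projection onto the
  span of the family. The sum then projects onto the orthogonal complement of that span in the image
  of \<open>A\<close>, and it is zero exactly when the family spans the image.\<close>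

definition resid :: "'a mat \<Rightarrow> nat \<Rightarrow> 'a mat \<Rightarrow> (nat \<Rightarrow> 'a vec) \<Rightarrow> 'a mat" where
  "resid A m B v = A + vmat m v * B * transpose_mat (vmat m v)"

lemma vmat_carrier [simp]: "vmat m v \<in> carrier_mat N m" by (simp add: vmat_def)

lemma vmat_dim [simp]: "dim_row (vmat m v) = N" "dim_col (vmat m v) = m" by (simp_all add: vmat_def)

lemma col_vmat: "j < m \<Longrightarrow> v j \<in> carrier_vec N \<Longrightarrow> col (vmat m v) j = v j"
  by (rule eq_vecI) (auto simp: vmat_def)

lemma frame_gram:
  assumes "frame A m B v" "B \<in> carrier_mat m m"
  shows "transpose_mat (vmat m v) * vmat m v = B"
proof (rule eq_matI)
  fix i j assume "i < dim_row B" "j < dim_col B"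
  then have "i < m" "j < m" using assms by auto
  then show "(transpose_mat (vmat m v) * vmat m v) $$ (i,j) = B $$ (i,j)"
    using assms(1) carrier_matD[OF vmat_carrier[of m v]] by (auto simp: frame_def col_vmat)
qed (use assms carrier_matD[OF vmat_carrier[of m v]] in auto)

lemma frame_fix:
  assumes "frame A m B v" "A \<in> M"
  shows "A * vmat m v = vmat m v"
proof (rule eq_matI)
  fix i j assume "i < dim_row (vmat m v)" "j < dim_col (vmat m v)"
  then have ij: "i < N" "j < m" by (auto simp: vmat_def)
  then have vj: "v j \<in> carrier_vec N" "A *\<^sub>v v j = v j" using assms(1) by (auto simp: frame_def)
  have "(A * vmat m v) $$ (i,j) = (A *\<^sub>v v j) $ i"
    using ij vj(1) assms(2) carrier_matD[OF vmat_carrier[of m v]] by (simp add: col_vmat)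
  also have "\<dots> = v j $ i" using vj(2) by simp
  finally show "(A * vmat m v) $$ (i,j) = vmat m v $$ (i,j)" using ij by (simp add: vmat_def)
qed (use assms carrier_matD[OF vmat_carrier[of m v]] in auto)

text \<open>Bounds the length of a family, so that families of maximal length exist.\<close>

lemma frame_le:
  assumes "frame A m B v" "B \<in> carrier_mat m m" "B * B = 1\<^sub>m m"
  shows "m \<le> N"
proof (rule mult_eq_one_dim_le)
  show "transpose_mat (vmat m v) * (vmat m v * B) = 1\<^sub>m m"
    using assoc_mult_mat[of "transpose_mat (vmat m v)" m N "vmat m v" m B m] assms(2,3)
      frame_gram[OF assms(1,2)] by simp
qed (use mult_carrier_mat[OF vmat_carrier assms(2)] in auto)

context
  fixes A B :: "'a mat" and m :: nat and v :: "nat \<Rightarrow> 'a vec"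
  assumes A: "A \<in> Sym" "A * A = A" and fr: "frame A m B v"
    and B: "B \<in> carrier_mat m m" "transpose_mat B = B" "B * B = 1\<^sub>m m"
begin

text \<open>With V^T V = B and B^2 = 1 the matrix Q = V B V^T satisfies V^T Q = V^T and is
  idempotent. Both \<open>A * Q\<close> and \<open>Q * A\<close> are Q, so \<open>A\<close> + Q is
  again a symmetric idempotent.\<close>

lemma resid_props:
  shows "resid A m B v \<in> Sym" "resid A m B v * resid A m B v = resid A m B v"
    "A * resid A m B v = resid A m B v"
    "transpose_mat (vmat m v) * resid A m B v = 0\<^sub>m m N"
proof -
  let ?V = "vmat m v" and ?W = "transpose_mat (vmat m v)"
  define Q where "Q = ?V * B * ?W"
  have AM: "A \<in> M" using A by (auto dest: SymD)
  have V: "?V \<in> carrier_mat N m" and W: "?W \<in> carrier_mat m N" by simp_all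
  have WV: "?W * ?V = B" by (rule frame_gram[OF fr B(1)])
  have AV: "A * ?V = ?V" by (rule frame_fix[OF fr AM])
  have WA: "?W * A = ?W" 
    using transpose_mult[OF AM V] SymD(2)[OF A(1)] AV by simp
  have VB: "?V * B \<in> carrier_mat N m" by (rule mult_carrier_mat[OF V B(1)])
  have QM: "Q \<in> M" unfolding Q_def by (rule mult_carrier_mat[OF VB W])
  have "transpose_mat Q = Q"
    unfolding Q_def transpose_mult[OF VB W] transpose_mult[OF V B(1)] B(2)
    using assoc_mult_mat[OF V B(1) W] by simp
  then have Qs: "Q \<in> Sym" using QM by (simp add: Sym_def)
  have AQ: "A * Q = Q" unfolding Q_def
    using assoc_mult_mat[OF AM VB W] assoc_mult_mat[OF AM V B(1)] AV by simp
  have QA: "Q * A = Q" unfolding Q_def using assoc_mult_mat[OF VB W AM] WA by simp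
  have WQ: "?W * Q = ?W"
  proof -
    have "?W * Q = ?W * (?V * (B * ?W))" unfolding Q_def using assoc_mult_mat[OF V B(1) W] by simp
    also have "\<dots> = (?W * ?V) * (B * ?W)" using assoc_mult_mat[OF W V mult_carrier_mat[OF B(1) W]] by simp
    also have "\<dots> = (B * B) * ?W" unfolding WV using assoc_mult_mat[OF B(1) B(1) W] by simp
    finally show ?thesis unfolding B(3) left_mult_one_mat[OF W] .
  qed
  have QQ: "Q * Q = Q"
    using assoc_mult_mat[OF VB W QM] WQ by (simp add: Q_def)
  have r: "resid A m B v = A + Q" by (simp add: resid_def Q_def)
  show "resid A m B v \<in> Sym" unfolding r by (rule subspaceD(2)[OF subspace_Sym A(1) Qs])
  show "resid A m B v * resid A m B v = resid A m B v"
    unfolding r using AM QM A(2) AQ QA QQ by (simp add: mring)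
  show "A * resid A m B v = resid A m B v"
    unfolding r using AM QM A(2) AQ by (simp add: mring)
  show "?W * resid A m B v = 0\<^sub>m m N"
    unfolding r mult_add_distrib_mat[OF W AM QM] WA WQ
    by (rule eq_matI) auto
qed

lemma resid_fix:
  assumes w: "w \<in> carrier_vec N" "resid A m B v *\<^sub>v w = w"
  shows "A *\<^sub>v w = w" "i < m \<Longrightarrow> v i \<bullet> w = 0" "i < m \<Longrightarrow> w \<bullet> v i = 0"
proof -
  let ?r = "resid A m B v"
  have AM: "A \<in> M" and rM: "?r \<in> M" using A resid_props(1) by (auto dest: SymD)
  show "A *\<^sub>v w = w"
    using assoc_mult_mat_vec[OF AM rM w(1)] resid_props(3) w(2) by simp
  have "transpose_mat (vmat m v) *\<^sub>v w = 0\<^sub>v m"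
  proof -
    have "transpose_mat (vmat m v) *\<^sub>v (?r *\<^sub>v w) = 0\<^sub>m m N *\<^sub>v w"
      using assoc_mult_mat_vec[of "transpose_mat (vmat m v)" m N ?r N w] rM w(1) resid_props(4) by simp
    also have "\<dots> = 0\<^sub>v m" using w(1) by (intro eq_vecI) auto
    finally show ?thesis using w(2) by simp
  qed
  then have *: "(transpose_mat (vmat m v) *\<^sub>v w) $ i = 0" if "i < m" for i using that by simp
  show 1: "v i \<bullet> w = 0" if "i < m" for i
    using *[OF that] that fr carrier_matD[OF vmat_carrier[of m v]] by (simp add: frame_def col_vmat)
  show "w \<bullet> v i = 0" if "i < m" for i
    using 1[OF that] comm_scalar_prod[OF w(1), of "v i"] fr that by (simp add: frame_def)
qed

end

text \<open>A nonzero entry of \<open>A\<close> at (i,j) is the scalar product of columns i and j,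
  because \<open>A\<close> is symmetric and idempotent. The vectors \<open>u\<close> and
  \<open>w\<close> may be proportional; they are a hyperbolic pair only once both are known to be
  isotropic.\<close>

lemma idem_pair:
  assumes A: "A \<in> Sym" "A * A = A" and nz: "A \<noteq> 0\<^sub>m N N"
  obtains u w where "u \<in> carrier_vec N" "w \<in> carrier_vec N" "A *\<^sub>v u = u" "A *\<^sub>v w = w"
    "u \<bullet> w = 1" "w \<bullet> u = 1"
proof -
  have AM: "A \<in> M" using A by (auto dest: SymD)
  obtain i j where ij: "i < N" "j < N" "A $$ (i,j) \<noteq> 0"
    using nz AM by (metis (no_types, lifting) eq_matI carrier_matD index_zero_mat zero_carrier_mat)
  define w where "w = A *\<^sub>v unit_vec N j"
  define u where "u = (1 / A $$ (i,j)) \<cdot>\<^sub>v (A *\<^sub>v unit_vec N i)"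
  have fixA: "A *\<^sub>v (A *\<^sub>v x) = A *\<^sub>v x" if "x \<in> carrier_vec N" for x
    using assoc_mult_mat_vec[OF AM AM that] A(2) by simp
  have e: "unit_vec N i \<in> carrier_vec N" "unit_vec N j \<in> carrier_vec N" by simp_all
  have Ae: "A *\<^sub>v unit_vec N i \<in> carrier_vec N" using AM by simp
  have w: "w \<in> carrier_vec N" "A *\<^sub>v w = w" using AM fixA[OF e(2)] by (simp_all add: w_def)
  have u: "u \<in> carrier_vec N" using Ae by (simp add: u_def)
  have Au: "A *\<^sub>v u = u" unfolding u_def mult_mat_vec[OF AM Ae] fixA[OF e(1)] ..
  have "(A *\<^sub>v unit_vec N i) \<bullet> w = unit_vec N i \<bullet> w"
    using Sym_scalar_prod[OF A(1) e(1) w(1)] w(2) by simp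
  also have "\<dots> = A $$ (i,j)" using ij AM w(1) by (simp add: w_def)
  finally have "u \<bullet> w = 1" using ij Ae w(1) by (simp add: u_def)
  moreover have "w \<bullet> u = 1" using calculation comm_scalar_prod[OF w(1) u] by simp
  ultimately show thesis using that u w Au by blast
qed

text \<open>A maximal orthonormal family exhausts the image of \<open>A\<close>: an orthogonal complement without
  anisotropic vectors contains a hyperbolic pair \<open>u, w\<close>, and together with a member \<open>e\<close> of the family
  it can be replaced by the orthonormal triple \<open>e + u, e + w, e + u + w\<close>.\<close>
lemma orthonormal_frame:
  assumes A: "A \<in> Sym" "A * A = A" and sqrt: "\<And>c::'a. \<exists>s. s * s = c"
    and e: "e \<in> carrier_vec N" "A *\<^sub>v e = e" "e \<bullet> e \<noteq> 0"
  shows "\<exists>p v. frame A p (1\<^sub>m p) v \<and> resid A p (1\<^sub>m p) v = 0\<^sub>m N N"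
proof -
  have normal: "\<exists>w'. w' \<in> carrier_vec N \<and> C *\<^sub>v w' = w' \<and> w' \<bullet> w' = 1"
    if w: "w \<in> carrier_vec N" "C *\<^sub>v w = w" "w \<bullet> w \<noteq> 0" and C: "C \<in> M" for C w
  proof -
    obtain s where s: "s * s = w \<bullet> w" using sqrt by blast
    then have "s \<noteq> 0" using w by auto
    then have "((1/s) \<cdot>\<^sub>v w) \<bullet> ((1/s) \<cdot>\<^sub>v w) = 1"
      using w(1) by (simp add: s[symmetric])
    moreover have "C *\<^sub>v ((1/s) \<cdot>\<^sub>v w) = (1/s) \<cdot>\<^sub>v w" unfolding mult_mat_vec[OF C w(1)] w(2) ..
    ultimately show ?thesis using w(1) by (metis smult_carrier_vec)
  qed
  have AM: "A \<in> M" using A by (auto dest: SymD)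
  let ?P = "\<lambda>p. \<exists>v. frame A p (1\<^sub>m p) v"
  have bound: "p \<le> N" if "?P p" for p using that frame_le by auto
  obtain e' where e': "e' \<in> carrier_vec N" "A *\<^sub>v e' = e'" "e' \<bullet> e' = 1" using normal[OF e AM] by blast
  have P1: "?P 1" using e' by (intro exI[of _ "\<lambda>_. e'"]) (auto simp: frame_def)
  define p where "p = (GREATEST p. ?P p)"
  have Pp: "?P p" unfolding p_def by (rule GreatestI_nat[of ?P, OF P1 bound])
  have max: "q \<le> p" if "?P q" for q unfolding p_def by (rule Greatest_le_nat[of ?P, OF that bound])
  \<comment> \<open>Guarantees that the member \<open>v 0\<close>, which the exchange below uses up,
    exists.\<close>
  have p1: "1 \<le> p" by (rule max[OF P1])
  obtain v where v: "frame A p (1\<^sub>m p) v" using Pp by blast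
  let ?r = "resid A p (1\<^sub>m p) v"
  have I: "1\<^sub>m p \<in> carrier_mat p p" "transpose_mat (1\<^sub>m p) = (1\<^sub>m p :: 'a mat)" "1\<^sub>m p * 1\<^sub>m p = (1\<^sub>m p :: 'a mat)"
    by simp_all
  note rp = resid_props[OF A v I] and rf = resid_fix[OF A v I]
  have vv: "\<And>i. i < p \<Longrightarrow> v i \<in> carrier_vec N" "\<And>i. i < p \<Longrightarrow> A *\<^sub>v v i = v i"
    "\<And>i j. i < p \<Longrightarrow> j < p \<Longrightarrow> v i \<bullet> v j = (if i = j then 1 else 0)" using v by (auto simp: frame_def)
  have isotropic: "w \<bullet> w = 0" if w: "w \<in> carrier_vec N" "?r *\<^sub>v w = w" for w
  proof (rule ccontr)
    assume "w \<bullet> w \<noteq> 0"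
    then obtain w' where w': "w' \<in> carrier_vec N" "?r *\<^sub>v w' = w'" "w' \<bullet> w' = 1"
      using normal[OF w] rp(1) by (auto dest: SymD)
    note f = rf[OF w'(1,2)]
    have "frame A (Suc p) (1\<^sub>m (Suc p)) (v(p := w'))"
      using f w' vv by (auto simp: frame_def less_Suc_eq)
    then show False using max[of "Suc p"] by auto
  qed
  have "?r = 0\<^sub>m N N"
  proof (rule ccontr)
    assume "?r \<noteq> 0\<^sub>m N N"
    then obtain u w where uw: "u \<in> carrier_vec N" "w \<in> carrier_vec N" "?r *\<^sub>v u = u" "?r *\<^sub>v w = w"
      "u \<bullet> w = 1" "w \<bullet> u = 1" by (rule idem_pair[OF rp(1,2)])
    note fu = rf[OF uw(1,3)] and fw = rf[OF uw(2,4)] and iu = isotropic[OF uw(1,3)] and iw = isotropic[OF uw(2,4)]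
    \<comment> \<open>Each product of two of the new vectors contains
      \<open>v 0 \<bullet> v 0\<close> = 1. For distinct vectors \<open>u \<bullet> w\<close>
      cancels it; in the norm of the third vector the mixed terms cancel each other. The length
      grows from p to p + 2.\<close>
    define v' where "v' = v(0 := v 0 + u, p := v 0 + w, Suc p := v 0 + u + w)"
    have v0: "v 0 \<in> carrier_vec N" "A *\<^sub>v v 0 = v 0" "v 0 \<bullet> v 0 = 1" using vv[of 0] p1 by auto
    have i_cases: "i = 0 \<or> (1 \<le> i \<and> i < p) \<or> i = p \<or> i = Suc p" if "i < Suc (Suc p)" for i
      using that by auto
    have v0j: "v 0 \<bullet> v j = 0" "v j \<bullet> v 0 = 0" if "1 \<le> j" "j < p" for j using vv(3)[of 0 j] vv(3)[of j 0] that by auto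
    have "frame A (Suc (Suc p)) (1\<^sub>m (Suc (Suc p))) v'"
      unfolding frame_def
    proof (intro conjI allI impI)
      fix i assume i: "i < Suc (Suc p)"
      show "v' i \<in> carrier_vec N" using i_cases[OF i] v0 uw vv p1 by (auto simp: v'_def)
      show "A *\<^sub>v v' i = v' i" using i_cases[OF i] v0 uw vv p1 fu(1) fw(1) AM
        by (auto simp: v'_def mult_add_distrib_mat_vec)
      fix j assume j: "j < Suc (Suc p)"
      show "v' i \<bullet> v' j = 1\<^sub>m (Suc (Suc p)) $$ (i,j)"
        using i_cases[OF i] i_cases[OF j] v0 uw vv p1 fu(2,3) fw(2,3) iu iw v0j
        by (auto simp: v'_def add_scalar_prod_distrib[of _ N] scalar_prod_add_distrib[of _ N])
    qed
    then show False using max[of "Suc (Suc p)"] by auto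
  qed
  then show ?thesis using v by blast
qed

text \<open>A nonzero residual contains vectors with product 1, which form a hyperbolic pair since
  all norms vanish, so no square roots are needed. The halves \<open>x\<close> and \<open>y\<close>
  are kept apart because a further pair enters the ordering of \<open>Pi_mat\<close> in the middle
  and at the end.\<close>

lemma symplectic_frame:
  assumes A: "A \<in> Sym" "A * A = A" and alt: "\<And>e. e \<in> carrier_vec N \<Longrightarrow> A *\<^sub>v e = e \<Longrightarrow> e \<bullet> e = 0"
  shows "\<exists>k v. frame A (2*k) (Pi_mat k) v \<and> resid A (2*k) (Pi_mat k) v = 0\<^sub>m N N"
proof -
  let ?Q = "\<lambda>(k::nat) x y. (\<forall>i<k. x i \<in> carrier_vec N \<and> A *\<^sub>v x i = x i \<and> y i \<in> carrier_vec N \<and> A *\<^sub>v y i = y i) \<and>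
    (\<forall>i<k. \<forall>j<k. x i \<bullet> x j = 0 \<and> y i \<bullet> y j = 0 \<and> x i \<bullet> y j = (if i = j then 1 else 0) \<and>
      y i \<bullet> x j = (if i = j then 1 else 0))"
  have fr: "frame A (2*k) (Pi_mat k) (\<lambda>i. if i < k then x i else y (i - k))" if "?Q k x y" for k x y
    using that by (auto simp: frame_def Pi_mat_index)
  let ?P = "\<lambda>k. \<exists>x y. ?Q k x y"
  have bound: "k \<le> N" if k: "?P k" for k
  proof -
    obtain x y where "?Q k x y" using k by blast
    from frame_le[OF fr[OF this] Pi_mat_carrier Pi_mat_sq] show ?thesis by simp
  qed
  have P0: "?P 0" by (rule exI[of _ "\<lambda>_. 0\<^sub>v N"], rule exI[of _ "\<lambda>_. 0\<^sub>v N"]) auto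
  define k where "k = (GREATEST k. ?P k)"
  have Pk: "?P k" unfolding k_def by (rule GreatestI_nat[of ?P, OF P0 bound])
  have max: "q \<le> k" if "?P q" for q unfolding k_def by (rule Greatest_le_nat[of ?P, OF that bound])
  obtain x y where xy: "?Q k x y" using Pk by blast
  define v where "v = (\<lambda>i. if i < k then x i else y (i - k))"
  have v: "frame A (2*k) (Pi_mat k) v" unfolding v_def by (rule fr[OF xy])
  let ?r = "resid A (2*k) (Pi_mat k) v"
  note rp = resid_props[OF A v Pi_mat_carrier Pi_mat_transpose Pi_mat_sq] 
    and rf = resid_fix[OF A v Pi_mat_carrier Pi_mat_transpose Pi_mat_sq]
  have rx: "x i \<bullet> w = 0" "w \<bullet> x i = 0" "y i \<bullet> w = 0" "w \<bullet> y i = 0"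
    if w: "w \<in> carrier_vec N" "?r *\<^sub>v w = w" and i: "i < k" for w i
    using rf(2,3)[OF w, of i] rf(2,3)[OF w, of "i + k"] i by (auto simp: v_def)
  have "?r = 0\<^sub>m N N"
  proof (rule ccontr)
    assume "?r \<noteq> 0\<^sub>m N N"
    then obtain u w where uw: "u \<in> carrier_vec N" "w \<in> carrier_vec N" "?r *\<^sub>v u = u" "?r *\<^sub>v w = w"
      "u \<bullet> w = 1" "w \<bullet> u = 1" by (rule idem_pair[OF rp(1,2)])
    note fu = rf(1)[OF uw(1,3)] and fw = rf(1)[OF uw(2,4)] 
    note ou = rx[OF uw(1,3)] and ow = rx[OF uw(2,4)]
    have "?Q (Suc k) (x(k := u)) (y(k := w))"
      using xy uw fu fw ou ow alt[OF uw(1) fu] alt[OF uw(2) fw] by (auto simp: less_Suc_eq)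
    then have "?P (Suc k)" by blast
    then show False using max[of "Suc k"] by auto
  qed
  then show ?thesis using v by blast
qed

text \<open>A vanishing residual means A = V B V^T, and V^T already kills a vector orthogonal to the
  family.\<close>

lemma frame_complete_zero:
  assumes A: "A \<in> Sym" and fr: "frame A m B v" and B: "B \<in> carrier_mat m m"
    and res: "resid A m B v = 0\<^sub>m N N"
    and w: "w \<in> carrier_vec N" "\<And>i. i < m \<Longrightarrow> v i \<bullet> w = 0"
  shows "A *\<^sub>v w = 0\<^sub>v N"
proof -
  let ?V = "vmat m v" and ?W = "transpose_mat (vmat m v)"
  have V: "?V \<in> carrier_mat N m" and W: "?W \<in> carrier_mat m N" by simp_all
  have VB: "?V * B \<in> carrier_mat N m" by (rule mult_carrier_mat[OF V B])
  have "A = ?V * B * ?W"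
    using res SymD(1)[OF A] mult_carrier_mat[OF VB W] by (simp add: resid_def madd_eq_zero_iff)
  then have "A *\<^sub>v w = (?V * B) *\<^sub>v (?W *\<^sub>v w)" using assoc_mult_mat_vec[OF VB W w(1)] by simp
  also have "?W *\<^sub>v w = 0\<^sub>v m"
    using w fr carrier_matD[OF vmat_carrier[of m v]] by (intro eq_vecI) (auto simp: frame_def col_vmat)
  also have "(?V * B) *\<^sub>v 0\<^sub>v m = 0\<^sub>v N" using VB carrier_matD[OF VB] by (intro eq_vecI) auto
  finally show ?thesis .
qed

lemma compl_vec: "A \<in> M \<Longrightarrow> w \<in> carrier_vec N \<Longrightarrow> (1\<^sub>m N + A) *\<^sub>v w = w + A *\<^sub>v w"
  using add_mult_distrib_mat_vec[OF one_carrier_mat, of A N w] by simp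

lemma vadd_eq_self_imp: assumes "w \<in> carrier_vec N" "x \<in> carrier_vec N" "w + x = (w :: 'a vec)" shows "x = 0\<^sub>v N"
proof (rule eq_vecI)
  fix i assume "i < dim_vec (0\<^sub>v N :: 'a vec)"
  then show "x $ i = 0\<^sub>v N $ i" using arg_cong[OF assms(3), of "\<lambda>x. x $ i"] assms(1,2) by simp
qed (use assms in auto)

text \<open>The kernel and the image of \<open>A\<close> are orthogonal, so the two families
  together have a block diagonal Gram matrix. A vector orthogonal to all of them is killed by both
  \<open>A\<close> and 1 + \<open>A\<close>, hence zero, so they span the whole space. The image of
  \<open>A\<close> becomes the second block.\<close>

lemma adapted_basis:
  assumes A: "A \<in> Sym" "A * A = A"
    and fr1: "frame (1\<^sub>m N + A) a B1 v1" "resid (1\<^sub>m N + A) a B1 v1 = 0\<^sub>m N N"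
    and B1: "B1 \<in> carrier_mat a a" "transpose_mat B1 = B1" "B1 * B1 = 1\<^sub>m a"
    and fr2: "frame A b B2 v2" "resid A b B2 v2 = 0\<^sub>m N N"
    and B2: "B2 \<in> carrier_mat b b" "transpose_mat B2 = B2" "B2 * B2 = 1\<^sub>m b"
  shows "N = a + b" "lsa_isomorphic (model_lsa A) (oo1 B1 B2 a b)"
proof -
  define G where "G = diag_block B1 B2"
  define v where "v i = (if i < a then v1 i else v2 (i - a))" for i
  have AM: "A \<in> M" using A by (auto dest: SymD)
  note G = diag_block_carrier[OF B1(1) B2(1), folded G_def]
    transpose_diag_block[OF B1(1) B2(1) B1(2) B2(2), folded G_def]
    diag_block_sq[OF B1(1) B2(1) B1(3) B2(3), folded G_def]
  have v1: "v1 i \<in> carrier_vec N" "A *\<^sub>v v1 i = 0\<^sub>v N" if "i < a" for i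
  proof -
    show c: "v1 i \<in> carrier_vec N" using fr1 that by (auto simp: frame_def)
    have "v1 i + A *\<^sub>v v1 i = v1 i" using fr1 that c AM by (auto simp: frame_def compl_vec)
    then show "A *\<^sub>v v1 i = 0\<^sub>v N" using vadd_eq_self_imp[OF c _] AM c by simp
  qed
  have v2: "v2 i \<in> carrier_vec N" "A *\<^sub>v v2 i = v2 i" if "i < b" for i
    using fr2 that by (auto simp: frame_def)
  have v12: "v1 i \<bullet> v2 j = 0" "v2 j \<bullet> v1 i = 0" if "i < a" "j < b" for i j
  proof -
    have "v1 i \<bullet> v2 j = (A *\<^sub>v v1 i) \<bullet> v2 j"
      using Sym_scalar_prod[OF A(1), of "v1 i" "v2 j"] v1[of i] v2[of j] that by simp
    then show "v1 i \<bullet> v2 j = 0" using v1[of i] v2[of j] that by simp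
    then show "v2 j \<bullet> v1 i = 0" using comm_scalar_prod[of "v2 j" N "v1 i"] v1[of i] v2[of j] that by simp
  qed
  have fr: "frame (1\<^sub>m N) (a + b) G v"
    using fr1(1) fr2(1) v1 v2 v12
    by (auto simp: frame_def v_def G_def diag_block_index[OF B1(1) B2(1)])
  let ?I = "1\<^sub>m N :: 'a mat" and ?r = "resid (1\<^sub>m N) (a + b) G v"
  have I: "?I \<in> Sym" "?I * ?I = ?I" using one_Sym by simp_all
  note rp = resid_props[OF I fr G] and rf = resid_fix[OF I fr G]
  have res: "?r = 0\<^sub>m N N"
  proof (rule ccontr)
    assume "?r \<noteq> 0\<^sub>m N N"
    then obtain u w where w: "w \<in> carrier_vec N" "?r *\<^sub>v w = w" "u \<bullet> w = 1" "u \<in> carrier_vec N"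
      by (rule idem_pair[OF rp(1,2)])
    note o = rf(2)[OF w(1,2)]
    have o1: "v1 i \<bullet> w = 0" if "i < a" for i using o[of i] that by (simp add: v_def)
    have o2: "v2 i \<bullet> w = 0" if "i < b" for i using o[of "a + i"] that by (simp add: v_def)
    have "A *\<^sub>v w = 0\<^sub>v N" by (rule frame_complete_zero[OF A(1) fr2(1) B2(1) fr2(2) w(1) o2])
    moreover have "(1\<^sub>m N + A) *\<^sub>v w = 0\<^sub>v N"
      by (rule frame_complete_zero[OF compl_idem(1)[OF A] fr1(1) B1(1) fr1(2) w(1) o1])
    ultimately have "w = 0\<^sub>v N" using w(1) AM by (simp add: compl_vec)
    then show False using w by simp
  qed
  let ?P = "vmat (a + b) v"
  have PG: "?P * G \<in> carrier_mat N (a + b)" by (rule mult_carrier_mat[OF vmat_carrier G(1)])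
  have "?P * G * transpose_mat ?P = 1\<^sub>m N"
    using res mult_carrier_mat[OF PG, of "transpose_mat ?P" N] by (simp add: resid_def madd_eq_zero_iff)
  \<comment> \<open>The vanishing residual factors the identity of size N through dimension a + b;
    the Gram matrix gives the opposite inequality.\<close>
  then have "N \<le> a + b" using mult_eq_one_dim_le[OF PG, of "transpose_mat ?P"] by simp
  moreover have "a + b \<le> N" by (rule frame_le[OF fr G(1,3)])
  ultimately show ab: "N = a + b" by simp
  have PM: "?P \<in> M" using vmat_carrier[of "a + b" v] ab by simp
  show "lsa_isomorphic (model_lsa A) (oo1 B1 B2 a b)"
  proof (rule model_iso_oo1[OF A _ ab _ _ G_def])
    show "?P \<in> M" by (rule PM)
    show "transpose_mat ?P * ?P = G" by (rule frame_gram[OF fr G(1)])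
    show "G * G = 1\<^sub>m N" using G(3) ab by simp
    show "A * ?P = ?P * mat_diag N (\<lambda>i. if a \<le> i then 1 else 0)"
    proof (rule eq_matI)
      fix i j assume "i < dim_row (?P * mat_diag N (\<lambda>i. if a \<le> i then 1 else 0))"
        "j < dim_col (?P * mat_diag N (\<lambda>i. if a \<le> i then 1 else 0))"
      then have i: "i < N" and jN: "j < N" by (simp_all add: mat_diag_def)
      then have j: "j < a + b" unfolding ab by simp
      have vj: "v j \<in> carrier_vec N" using fr j by (auto simp: frame_def)
      have "(A * ?P) $$ (i,j) = (A *\<^sub>v v j) $ i"
        using i j vj AM carrier_matD[OF vmat_carrier[of "a + b" v]] by (simp add: col_vmat)
      also have "A *\<^sub>v v j = (if a \<le> j then v j else 0\<^sub>v N)"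
        using v1[of j] v2[of "j - a"] j by (auto simp: v_def)
      also have "\<dots> $ i = (?P * mat_diag N (\<lambda>i. if a \<le> i then 1 else 0)) $$ (i,j)"
        using i j jN by (simp add: mat_diag_mult_right[OF PM]) (simp add: vmat_def)
      finally show "(A * ?P) $$ (i,j) = (?P * mat_diag N (\<lambda>i. if a \<le> i then 1 else 0)) $$ (i,j)" .
    qed (use AM ab carrier_matD[OF vmat_carrier[of "a + b" v]] in \<open>auto simp: mat_diag_def\<close>)
  qed
qed

text \<open>The cases are distinguished by whether some vector of the image of \<open>A\<close> has
  nonzero norm.\<close>

lemma frame_cases:
  assumes A: "A \<in> Sym" "A * A = A" and sqrt: "\<And>c::'a. \<exists>s. s * s = c"
  obtains (orthonormal) p v where "frame A p (1\<^sub>m p) v" "resid A p (1\<^sub>m p) v = 0\<^sub>m N N"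
  | (symplectic) k v where "frame A (2*k) (Pi_mat k) v" "resid A (2*k) (Pi_mat k) v = 0\<^sub>m N N"
  using orthonormal_frame[OF A sqrt] symplectic_frame[OF A] by blast

text \<open>As \<open>N\<close> is odd, exactly one of \<open>A\<close> and \<open>1 + A\<close> has even rank. An image of odd dimension is
  not alternating, so it has an orthonormal basis.\<close>
lemma model_lsa_classification:
  assumes A: "A \<in> Sym" "A * A = A" and sqrt: "\<And>c::'a. \<exists>s. s * s = c" and odd: "odd N"
  obtains A' where "A' \<in> Sym" "A' * A' = A'" "Ev A' = Ev A" "Od A' = Od A"
    "(\<exists>k. 2*k \<le> N \<and> lsa_isomorphic (model_lsa A') (oo1 (1\<^sub>m (N-2*k)) (1\<^sub>m (2*k)) (N-2*k) (2*k))) \<or>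
     (\<exists>k. 1 \<le> k \<and> 2*k \<le> N \<and> lsa_isomorphic (model_lsa A') (oo1 (1\<^sub>m (N-2*k)) (Pi_mat k) (N-2*k) (2*k)))"
proof -
  let ?concl = "\<lambda>A'. (\<exists>k. 2*k \<le> N \<and> lsa_isomorphic (model_lsa A') (oo1 (1\<^sub>m (N-2*k)) (1\<^sub>m (2*k)) (N-2*k) (2*k))) \<or>
     (\<exists>k. 1 \<le> k \<and> 2*k \<le> N \<and> lsa_isomorphic (model_lsa A') (oo1 (1\<^sub>m (N-2*k)) (Pi_mat k) (N-2*k) (2*k)))"
  have I: "1\<^sub>m p \<in> carrier_mat p p" "transpose_mat (1\<^sub>m p) = (1\<^sub>m p :: 'a mat)" "1\<^sub>m p * 1\<^sub>m p = (1\<^sub>m p :: 'a mat)" for p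
    by simp_all
  note J = Pi_mat_carrier Pi_mat_transpose Pi_mat_sq
  \<comment> \<open>An orthonormal first block of odd size forces the second block to have even
    size, whichever type it has.\<close>
  have main: "?concl C" if C: "C \<in> Sym" "C * C = C"
    and fr: "frame (1\<^sub>m N + C) p (1\<^sub>m p) v" "resid (1\<^sub>m N + C) p (1\<^sub>m p) v = 0\<^sub>m N N" and p: "odd p" for C p v
    using C sqrt
  proof (cases rule: frame_cases)
    case (orthonormal q w)
    note ab = adapted_basis[OF C fr I orthonormal I]
    then have "even q" using odd p by (metis even_add)
    then obtain k where k: "q = 2 * k" by blast
    then have "2 * k \<le> N" "N - 2 * k = p" using ab(1) by auto
    then show ?thesis using ab(2) k by auto
  next
    case (symplectic k w)
    note ab = adapted_basis[OF C fr I symplectic J]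
    have N: "2 * k \<le> N" "N - 2 * k = p" using ab(1) by auto
    show ?thesis
    proof (cases "k = 0")
      case True
      \<comment> \<open>The empty second block is counted in the orthonormal family, since the
        family with Pi starts at k = 1.\<close>
      have "Pi_mat 0 = (1\<^sub>m 0 :: 'a mat)" by (intro eq_matI) auto
      then show ?thesis using ab(2) N True by (intro disjI1 exI[of _ 0]) auto
    next
      case False
      then show ?thesis using ab(2) N by (intro disjI2 exI[of _ k]) auto
    qed
  qed
  have AM: "A \<in> M" using A by (auto dest: SymD)
  let ?B = "1\<^sub>m N + A"
  note B = compl_idem[OF A] and eq = Ev_Od_compl[OF AM]
  \<comment> \<open>Replacing \<open>A\<close> by its complement swaps the blocks; it is done when
    the odd-dimensional summand is the image of \<open>A\<close>.\<close>
  have BB: "1\<^sub>m N + ?B = A" using AM by (simp add: mring)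
  have compl: "frame (1\<^sub>m N + ?B) q (1\<^sub>m q) w" "resid (1\<^sub>m N + ?B) q (1\<^sub>m q) w = 0\<^sub>m N N"
    if "frame A q (1\<^sub>m q) w" "resid A q (1\<^sub>m q) w = 0\<^sub>m N N" for q w
    unfolding BB by (rule that)+
  show thesis
    using B sqrt
  proof (cases rule: frame_cases)
    case b: (orthonormal p v)
    show thesis
    proof (cases "odd p")
      case True
      then show thesis using that[OF A refl refl main[OF A b]] by simp
    next
      case ev: False
      show thesis using A sqrt
      proof (cases rule: frame_cases)
        case a: (orthonormal q w)
        have "N = p + q" by (rule adapted_basis(1)[OF A b I a I])
        then have "odd q" using odd ev by simp
        then show thesis by (rule that[OF B eq main[OF B compl[OF a]]])
      next
        case a: (symplectic q w)
        have "N = p + 2 * q" by (rule adapted_basis(1)[OF A b I a J])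
        then show thesis using odd ev by simp
      qed
    qed
  next
    case b: (symplectic k v)
    show thesis using A sqrt
    proof (cases rule: frame_cases)
      case a: (orthonormal q w)
      have "N = 2 * k + q" by (rule adapted_basis(1)[OF A b J a I])
      then have "odd q" using odd by simp
      then show thesis by (rule that[OF B eq main[OF B compl[OF a]]])
    next
      case a: (symplectic q w)
      have "N = 2 * k + 2 * q" by (rule adapted_basis(1)[OF A b J a J])
      then show thesis using odd by simp
    qed
  qed
qed

subsection \<open>Gradings and idempotents\<close>

text \<open>The projection onto \<open>g1\<close> multiplies degree i by i, and degrees add modulo 2
  just as the scalars 0 and 1 do in characteristic 2. It is therefore a derivation: in the Leibniz
  rule the bracket of two odd components occurs twice and cancels.\<close>

lemma grading_idempotent:
  assumes N: "N \<ge> 3"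
    and quadratic: "\<And>c::'a. \<exists>t. t * t + t = c"
    and inner: "\<And>D. is_derivation Alt D \<Longrightarrow> \<exists>A\<in>Sym. \<forall>y\<in>Alt. D y = comm A y"
    and gr: "is_Z2_grading N Alt g0 g1"
  obtains A where "A \<in> Sym" "A * A = A" "g0 = Alt \<inter> Ev A" "g1 = Od A"
proof -
  have s0: "is_subspace N g0" and s1: "is_subspace N g1" and sub: "g0 \<subseteq> Alt" "g1 \<subseteq> Alt"
    and int: "g0 \<inter> g1 = {0\<^sub>m N N}" and dec: "\<And>x. x \<in> Alt \<Longrightarrow> \<exists>u\<in>g0. \<exists>v\<in>g1. x = u + v"
    and c00: "\<And>x y. x \<in> g0 \<Longrightarrow> y \<in> g0 \<Longrightarrow> comm x y \<in> g0"
    and c01: "\<And>x y. x \<in> g0 \<Longrightarrow> y \<in> g1 \<Longrightarrow> comm x y \<in> g1"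
    and c10: "\<And>x y. x \<in> g1 \<Longrightarrow> y \<in> g0 \<Longrightarrow> comm x y \<in> g1"
    and c11: "\<And>x y. x \<in> g1 \<Longrightarrow> y \<in> g1 \<Longrightarrow> comm x y \<in> g0"
    using gr unfolding is_Z2_grading_def by auto
  note S0 = subspaceD[OF s0] and S1 = subspaceD[OF s1]
  have gM: "x \<in> M" if "x \<in> g0 \<or> x \<in> g1" for x using that sub by (auto dest: AltD(2))
  \<comment> \<open>Directness of the sum makes the chosen component unique.\<close>
  define D where "D x = (SOME v. v \<in> g1 \<and> (\<exists>u\<in>g0. x = u + v))" for x
  have D: "D (u + v) = v" if u: "u \<in> g0" and v: "v \<in> g1" for u v
  proof -
    have "D (u + v) \<in> g1 \<and> (\<exists>u'\<in>g0. u + v = u' + D (u + v))"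
      unfolding D_def by (rule someI[of _ v]) (use u v in blast)
    then obtain u' w where u': "u' \<in> g0" and w: "w \<in> g1" and eq: "u + v = u' + w" and Dw: "D (u + v) = w"
      by blast
    note MM = gM[OF disjI1[OF u]] gM[OF disjI2[OF v]] gM[OF disjI1[OF u']] gM[OF disjI2[OF w]]
    have "u' + u = u' + (u + v) + v" using MM(1-3) by (simp add: mring)
    also have "\<dots> = w + v" unfolding eq using MM by (simp add: mring)
    finally have "u' + u = w + v" .
    moreover have "u' + u \<in> g0" "w + v \<in> g1" using S0(2)[OF u' u] S1(2)[OF w v] by auto
    ultimately have "w + v = 0\<^sub>m N N" using int by auto
    then show "D (u + v) = v" using MM Dw by (simp add: madd_eq_zero_iff)
  qed
  have D0: "D u = 0\<^sub>m N N" if "u \<in> g0" for u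
    using D[OF that S1(1)] gM that by (simp add: mring)
  have D1: "D v = v" if "v \<in> g1" for v
    using D[OF S0(1) that] gM that by (simp add: mring)
  have der: "is_derivation Alt D"
    unfolding is_derivation_def
  proof (intro conjI ballI allI)
    fix x y c assume "x \<in> Alt"
    then obtain u v where x: "u \<in> g0" "v \<in> g1" "x = u + v" using dec by blast
    have xM: "u \<in> M" "v \<in> M" using gM x by auto
    show "D x \<in> Alt" using x D sub by auto
    have "c \<cdot>\<^sub>m x = c \<cdot>\<^sub>m u + c \<cdot>\<^sub>m v" using x xM by (simp add: mring)
    then show "D (c \<cdot>\<^sub>m x) = c \<cdot>\<^sub>m D x" using D[OF S0(3) S1(3), of u v c c] D x by simp
    assume "y \<in> Alt"
    then obtain u' v' where y: "u' \<in> g0" "v' \<in> g1" "y = u' + v'" using dec by blast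
    have yM: "u' \<in> M" "v' \<in> M" using gM y by auto
    have "x + y = (u + u') + (v + v')" using x y xM yM by (simp add: mring)
    then show "D (x + y) = D x + D y" using D[OF S0(2) S1(2), of u u' v v'] D x y by simp
    have "comm x y = (comm u u' + comm v v') + (comm u v' + comm v u')"
      using x y xM yM by (simp add: mring comm_eq)
    then have "D (comm x y) = comm u v' + comm v u'"
      using D[OF S0(2)[OF c00[OF x(1) y(1)] c11[OF x(2) y(2)]] S1(2)[OF c01[OF x(1) y(2)] c10[OF x(2) y(1)]]] by simp
    also have "\<dots> = comm v y + comm x v'" using x y xM yM by (simp add: mring comm_eq)
    finally show "D (comm x y) = comm (D x) y + comm x (D y)" using D x y by simp
  qed
  obtain A0 where A0: "A0 \<in> Sym" and DA: "\<And>y. y \<in> Alt \<Longrightarrow> D y = comm A0 y"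
    using inner[OF der] by blast
  have A0M: "A0 \<in> M" using A0 by (rule SymD)
  have DD: "D (D y) = D y" "D y \<in> g1" if y: "y \<in> Alt" for y
  proof -
    obtain u v where "u \<in> g0" "v \<in> g1" "y = u + v" using dec[OF y] by blast
    then show "D (D y) = D y" "D y \<in> g1" using D D1 by auto
  qed
  have "(A0 * A0 + A0) * Y = Y * (A0 * A0 + A0)" if Y: "Y \<in> Alt" for Y
  proof -
    have YM: "Y \<in> M" using AltD(2)[OF Y] .
    have ZM: "A0 * A0 + A0 \<in> M" using A0M by simp
    have "comm A0 (comm A0 Y) = comm A0 Y"
      using DD(1)[OF Y] DA[OF Y] DA[OF ad_closed[OF A0 Y]] by simp
    then have "comm A0 (comm A0 Y) + comm A0 Y = 0\<^sub>m N N" using A0M YM by (simp add: madd_self)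
    moreover have "comm A0 (comm A0 Y) + comm A0 Y = (A0 * A0 + A0) * Y + Y * (A0 * A0 + A0)"
      using A0M YM by (simp add: mring comm_eq)
    ultimately show ?thesis using madd_eq_zero_iff[OF mult_closed[OF ZM YM] mult_closed[OF YM ZM]] by simp
  qed
  then obtain c where c: "A0 * A0 + A0 = c \<cdot>\<^sub>m 1\<^sub>m N"
    using centralizer_Alt[OF N, of "A0 * A0 + A0"] A0M by auto
  \<comment> \<open>With this choice (A0 + t)^2 = A0 + c + t^2 = A0 + t.\<close>
  obtain t where t: "t * t + t = c" using quadratic by blast
  define A where "A = A0 + t \<cdot>\<^sub>m 1\<^sub>m N"
  have AS: "A \<in> Sym" unfolding A_def
    by (rule subspaceD(2)[OF subspace_Sym A0 subspaceD(3)[OF subspace_Sym one_Sym]])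
  have AM: "A \<in> M" using AS by (rule SymD)
  have "A * A = A0 * A0 + t \<cdot>\<^sub>m (t \<cdot>\<^sub>m 1\<^sub>m N)"
    unfolding A_def using A0M by (simp add: mring)
  also have "t \<cdot>\<^sub>m (t \<cdot>\<^sub>m 1\<^sub>m N) = (t * t) \<cdot>\<^sub>m 1\<^sub>m N" by (intro eq_matI) auto
  also have "A0 * A0 = A0 + c \<cdot>\<^sub>m 1\<^sub>m N"
    unfolding c[symmetric] using A0M by (simp add: mring)
  also have "A0 + c \<cdot>\<^sub>m 1\<^sub>m N + (t * t) \<cdot>\<^sub>m 1\<^sub>m N = A0 + (c + t * t) \<cdot>\<^sub>m 1\<^sub>m N"
    using A0M by (simp add: madd_assoc msmult_add_scalar)
  also have "c + t * t = t + (t * t + t * t)" unfolding t[symmetric] by (simp only: ac_simps)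
  also have "\<dots> = t" by (simp only: add_self add_0_right)
  finally have idem: "A * A = A" by (simp add: A_def)
  have cA: "comm A y = D y" if "y \<in> Alt" for y
    using DA[OF that] A0M AltD(2)[OF that] by (simp add: A_def comm_eq mring)
  \<comment> \<open>\<open>Ev A\<close> also contains non-alternating matrices such as the identity,
    whereas \<open>Od A\<close> lies in \<open>Alt\<close> by itself.\<close>
  have "g0 = Alt \<inter> Ev A"
  proof (intro equalityI subsetI)
    fix x assume x: "x \<in> g0"
    then have "A * x + x * A = 0\<^sub>m N N" using cA[of x] D0[OF x] sub by (auto simp: comm_eq)
    moreover have "x \<in> M" using gM x by blast
    ultimately have "A * x = x * A" using AM by (simp add: madd_eq_zero_iff)
    then show "x \<in> Alt \<inter> Ev A" using x sub by (auto simp: Ev_def dest: AltD)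
  next
    fix x assume x: "x \<in> Alt \<inter> Ev A"
    then obtain u v where uv: "u \<in> g0" "v \<in> g1" "x = u + v" using dec by blast
    have "D x = 0\<^sub>m N N" using cA[of x] x EvD(2,3)[of x A] AM by (auto simp: comm_eq madd_self)
    then have "v = 0\<^sub>m N N" using D uv by simp
    then show "x \<in> g0" using uv gM by simp
  qed
  moreover have "g1 = Od A"
  proof (intro equalityI subsetI)
    fix x assume x: "x \<in> g1"
    then have "A * x + x * A = x" using cA[of x] D1[OF x] sub by (auto simp: comm_eq)
    then show "x \<in> Od A" using x sub by (auto simp: Od_def dest: AltD)
  next
    fix x assume x: "x \<in> Od A"
    then have xA: "x \<in> Alt" using Od_Alt[OF AS] by blast
    then have "D x = x" using cA[of x] OdD(3)[OF x] by (simp add: comm_eq)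
    then show "x \<in> g1" using DD(2)[OF xA] by simp
  qed
  ultimately show thesis using that[OF AS idem] by blast
qed

end

section \<open>Classification over an algebraically closed field\<close>

theorem theorem3p2:
  fixes n :: nat and g0 g1 :: "'a::alg_closed_field mat set"
  assumes "CHAR('a) = 2"
    and "n \<ge> 1"
    and "\<forall>D. is_derivation (orth1 (2*n+1) :: 'a mat set) D \<longrightarrow>
           (\<exists>A \<in> orth (2*n+1). \<forall>y \<in> orth1 (2*n+1). D y = comm A y)"
    and "is_Z2_grading (2*n+1) (orth1 (2*n+1)) g0 g1"
  shows "(\<exists>k. k \<le> n \<and> lsa_isomorphic (S_g_one (2*n+1) (orth1 (2*n+1)) g0 g1)
              (oo1 (1\<^sub>m (2*n+1-2*k)) (1\<^sub>m (2*k)) (2*n+1-2*k) (2*k))) \<or>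
         (\<exists>k. 1 \<le> k \<and> k \<le> n \<and> lsa_isomorphic (S_g_one (2*n+1) (orth1 (2*n+1)) g0 g1)
              (oo1 (1\<^sub>m (2*n+1-2*k)) (Pi_mat k) (2*n+1-2*k) (2*k)))"
proof -
  define N where "N = 2 * n + 1"
  have N: "N \<ge> 3" "odd N" using assms(2) by (auto simp: N_def)
  interpret char2_mat N "TYPE('a)" by unfold_locales (rule assms(1))
  have sqrt: "\<exists>s. s * s = c" for c :: 'a
    using nth_root_exists[of 2 c] by (auto simp: power2_eq_square)
  have quadratic: "\<exists>t. t * t + t = c" for c :: 'a
  proof -
    obtain t where "poly [:c, 1, 1:] t = 0" using alg_closed_imp_poly_has_root[of "[:c, 1, 1:]"] by auto
    then have "c + (t * t + t) = 0" by (simp add: algebra_simps)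
    then have "t * t + t = c" by (metis add_eq_0_iff uminus_eq)
    then show ?thesis by blast
  qed
  obtain A where A: "A \<in> Sym" "A * A = A" "g0 = Alt \<inter> Ev A" "g1 = Od A"
    using grading_idempotent[OF N(1) quadratic _ assms(4)[folded N_def, unfolded orth1_eq_Alt]]
      assms(3)[folded N_def, unfolded orth1_eq_Alt orth_eq_Sym] by blast
  obtain A' where A': "A' \<in> Sym" "A' * A' = A'" "Ev A' = Ev A" "Od A' = Od A" and iso:
    "(\<exists>k. 2*k \<le> N \<and> lsa_isomorphic (model_lsa A') (oo1 (1\<^sub>m (N-2*k)) (1\<^sub>m (2*k)) (N-2*k) (2*k))) \<or>
     (\<exists>k. 1 \<le> k \<and> 2*k \<le> N \<and> lsa_isomorphic (model_lsa A') (oo1 (1\<^sub>m (N-2*k)) (Pi_mat k) (N-2*k) (2*k)))"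
    by (rule model_lsa_classification[OF A(1,2) sqrt N(2)])
  \<comment> \<open>The classification may have passed to the complementary idempotent; as it has
    the same even and odd parts, it describes the same grading.\<close>
  have "lsa_isomorphic (S_g_one N (orth1 N) g0 g1) L" if "lsa_isomorphic (model_lsa A') L" for L :: "('a, 'a mat) lsa"
    using lsa_isomorphic_common_source[OF model_iso_S_g_one[OF A'(1,2) N] that] model_closed[OF A'(1,2)]
    unfolding orth1_eq_Alt A(3,4) A'(3,4) by blast
  moreover have "2 * k \<le> N \<longleftrightarrow> k \<le> n" for k by (auto simp: N_def)
  ultimately show ?thesis using iso unfolding N_def[symmetric] by blast
qed

end
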